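(* Let $K$ be a field and let $\Delta$ be a simplicial complex on $V$ with $\dim\Delta\ge 2$. Assume that the Stanley--Reisner ring $K[\Delta]$ satisfies Serre's condition $(S_2)$. Then the following conditions are equivalent: (1) $K[\Delta]$ is a complete intersection ring (that is, $I_\Delta$ is generated by a regular sequence); (2) for every face $F\in\Delta$ with $\dim \mathrm{link}_\Delta(F)=1$, $\mathrm{link}_\Delta(F)$ is a complete intersection complex; (3) there exists a subset $W\subseteq V$ with $\dim \Delta_{V\setminus W}\le \dim\Delta-3$ such that $\mathrm{link}_\Delta(\{x\})$ is a complete intersection complex for all $x\in W$.
   Context: A simplicial complex $\Delta$ on a vertex set $V=[n]=\{1,\dots,n\}$ is a nonempty family of subsets of $V$ such that $\{v\}\in\Delta$ for every $v\in V$, and $F\in\Delta$, $G\subseteq F$ imply $G\in\Delta$. The dimension of a face $F$ is $\sharp(F)-1$, and the dimension of a complex is the maximum of the dimensions of its faces (so $\dim\{\emptyset\}=-1$). Let $S=K[X_1,\dots,X_n]$. The Stanley--Reisner ideal $I_\Delta\subseteq S$ is generated by all squarefree monomials $X_{i_1}\cdots X_{i_p}$ ($i_1<\cdots<i_p$) with $\{i_1,\dots,i_p\}\notin\Delta$, and $K[\Delta]=S/I_\Delta$. The link of a face $F$ is $\mathrm{link}_\Delta(F)=\{G\in\Delta : G\cup F\in\Delta,\ G\cap F=\emptyset\}$, regarded as a complex on the set of its own vertices; the restriction of $\Delta$ to $U\subseteq V$ is $\Delta_U=\{G\in\Delta : G\subseteq U\}$. A simplicial complex is a complete intersection complex if its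 Stanley--Reisner ideal is generated by a regular sequence (the zero ideal is allowed). A Noetherian ring $R$ satisfies $(S_2)$ if $\mathrm{depth}\, R_P\ge\min\{\dim R_P,2\}$ for every prime ideal $P$ of $R$. *)

theory Defs
  imports "HOL-Algebra.QuotRing" "HOL-Library.Poly_Mapping" "HOL-Library.Extended_Nat"
begin

section \<open>Commutative algebra\<close>

text \<open>The elements of \<open>xs\<close> form an \<open>R\<close>-regular sequence. The condition
  \<open>a \<otimes> xs!i \<in> J \<longrightarrow> a \<in> J\<close> says that \<open>xs!i\<close> is a nonzerodivisor on \<open>R/J\<close>, where \<open>J\<close> is
  generated by the preceding elements. The empty sequence is regular iff \<open>R\<close> is nonzero.\<close>

definition regular_seq :: "('a, 'b) ring_scheme \<Rightarrow> 'a list \<Rightarrow> bool" where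
  "regular_seq R xs \<longleftrightarrow>
     set xs \<subseteq> carrier R \<and>
     (\<forall>i<length xs. \<forall>a\<in>carrier R.
        a \<otimes>\<^bsub>R\<^esub> xs ! i \<in> Idl\<^bsub>R\<^esub> (set (take i xs)) \<longrightarrow> a \<in> Idl\<^bsub>R\<^esub> (set (take i xs))) \<and>
     Idl\<^bsub>R\<^esub> (set xs) \<noteq> carrier R"

text \<open>The zero ideal of a nonzero ring qualifies, via the empty sequence.\<close>

definition generated_by_regular_seq :: "('a, 'b) ring_scheme \<Rightarrow> 'a set \<Rightarrow> bool" where
  "generated_by_regular_seq R I \<longleftrightarrow> (\<exists>xs. regular_seq R xs \<and> I = Idl\<^bsub>R\<^esub> (set xs))"

text \<open>The supremum of the lengths \<open>k\<close> of chains \<open>p 0 \<subset> \<dots> \<subset> p k\<close> of prime ideals. The zero ring,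
  which has no prime ideal, gets the value \<open>0\<close>; it does not occur as a localization at a prime.\<close>

definition krull_dim :: "('a, 'b) ring_scheme \<Rightarrow> enat" where
  "krull_dim R = Sup {enat k | k. \<exists>p :: nat \<Rightarrow> 'a set.
     (\<forall>i\<le>k. primeideal (p i) R) \<and> (\<forall>i<k. p i \<subset> p (Suc i))}"

text \<open>The depth of a Noetherian local ring: the maximal length of a regular sequence in its
  maximal ideal, which is the set of its nonunits.\<close>

definition local_depth :: "('a, 'b) ring_scheme \<Rightarrow> enat" where
  "local_depth R = Sup {enat (length xs) | xs.
     regular_seq R xs \<and> set xs \<subseteq> carrier R - Units R}"

text \<open>The localization \<open>R\<^sub>P\<close> of a commutative ring at a prime ideal. Fractions are equivalence
  classes of pairs; as in \<open>FactRing\<close>, the operations are lifted elementwise to the classes.\<close>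

definition fraction :: "('a, 'b) ring_scheme \<Rightarrow> 'a set \<Rightarrow> 'a \<Rightarrow> 'a \<Rightarrow> ('a \<times> 'a) set" where
  "fraction R P r s = {(r', s'). r' \<in> carrier R \<and> s' \<in> carrier R - P \<and>
     (\<exists>u\<in>carrier R - P. u \<otimes>\<^bsub>R\<^esub> (s' \<otimes>\<^bsub>R\<^esub> r) = u \<otimes>\<^bsub>R\<^esub> (s \<otimes>\<^bsub>R\<^esub> r'))}"

definition localization :: "('a, 'b) ring_scheme \<Rightarrow> 'a set \<Rightarrow> ('a \<times> 'a) set ring" where
  "localization R P =
     \<lparr>carrier = {fraction R P r s | r s. r \<in> carrier R \<and> s \<in> carrier R - P},
      mult = (\<lambda>A B. \<Union>(r, s)\<in>A. \<Union>(r', s')\<in>B. fraction R P (r \<otimes>\<^bsub>R\<^esub> r') (s \<otimes>\<^bsub>R\<^esub> s')),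
      one = fraction R P \<one>\<^bsub>R\<^esub> \<one>\<^bsub>R\<^esub>,
      zero = fraction R P \<zero>\<^bsub>R\<^esub> \<one>\<^bsub>R\<^esub>,
      add = (\<lambda>A B. \<Union>(r, s)\<in>A. \<Union>(r', s')\<in>B.
               fraction R P (r \<otimes>\<^bsub>R\<^esub> s' \<oplus>\<^bsub>R\<^esub> r' \<otimes>\<^bsub>R\<^esub> s) (s \<otimes>\<^bsub>R\<^esub> s'))\<rparr>"

text \<open>Serre's condition \<open>(S\<^sub>2)\<close>, meant for Noetherian rings \<open>R\<close>.\<close>

definition serre_S2 :: "('a, 'b) ring_scheme \<Rightarrow> bool" where
  "serre_S2 R \<longleftrightarrow>
     (\<forall>P. primeideal P R \<longrightarrow>
        local_depth (localization R P) \<ge> min (krull_dim (localization R P)) 2)"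


section \<open>Simplicial complexes\<close>

definition simplicial_complex :: "'v set \<Rightarrow> 'v set set \<Rightarrow> bool" where
  "simplicial_complex V \<Delta> \<longleftrightarrow>
     \<Delta> \<noteq> {} \<and> \<Delta> \<subseteq> Pow V \<and> (\<forall>v\<in>V. {v} \<in> \<Delta>) \<and> (\<forall>F\<in>\<Delta>. \<forall>G. G \<subseteq> F \<longrightarrow> G \<in> \<Delta>)"

definition face_dim :: "'v set \<Rightarrow> int" where
  "face_dim F = int (card F) - 1"

definition complex_dim :: "'v set set \<Rightarrow> int" where
  "complex_dim \<Delta> = Max (face_dim ` \<Delta>)"

definition link :: "'v set set \<Rightarrow> 'v set \<Rightarrow> 'v set set" where
  "link \<Delta> F = {G \<in> \<Delta>. G \<union> F \<in> \<Delta> \<and> G \<inter> F = {}}"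

definition restriction :: "'v set set \<Rightarrow> 'v set \<Rightarrow> 'v set set" where
  "restriction \<Delta> U = {G \<in> \<Delta>. G \<subseteq> U}"


section \<open>Stanley--Reisner rings\<close>

text \<open>The polynomial ring \<open>K[X\<^sub>v | v \<in> V]\<close>: a monomial is its exponent vector of type
  \<open>'v \<Rightarrow>\<^sub>0 nat\<close>, and the carrier consists of the polynomials involving only variables from \<open>V\<close>.\<close>

definition polynomial_ring ::
    "'k::field itself \<Rightarrow> 'v set \<Rightarrow> (('v \<Rightarrow>\<^sub>0 nat) \<Rightarrow>\<^sub>0 'k) ring" where
  "polynomial_ring _ V =
     \<lparr>carrier = {p. \<forall>m\<in>Poly_Mapping.keys p. Poly_Mapping.keys m \<subseteq> V},
      mult = (*), one = 1, zero = 0, add = (+)\<rparr>"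

text \<open>The product of the variables \<open>X\<^sub>v\<close> over a finite set \<open>F\<close>.\<close>

definition squarefree_monomial :: "'v set \<Rightarrow> ('v \<Rightarrow>\<^sub>0 nat) \<Rightarrow>\<^sub>0 'k::field" where
  "squarefree_monomial F = Poly_Mapping.single (\<Sum>v\<in>F. Poly_Mapping.single v 1) 1"

definition stanley_reisner_ideal ::
    "'k::field itself \<Rightarrow> 'v set \<Rightarrow> 'v set set \<Rightarrow> (('v \<Rightarrow>\<^sub>0 nat) \<Rightarrow>\<^sub>0 'k) set" where
  "stanley_reisner_ideal K V \<Delta> =
     Idl\<^bsub>polynomial_ring K V\<^esub> {squarefree_monomial F | F. F \<subseteq> V \<and> F \<notin> \<Delta>}"

definition stanley_reisner_ring ::
    "'k::field itself \<Rightarrow> 'v set \<Rightarrow> 'v set set \<Rightarrow> (('v \<Rightarrow>\<^sub>0 nat) \<Rightarrow>\<^sub>0 'k) set ring" where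
  "stanley_reisner_ring K V \<Delta> = polynomial_ring K V Quot stanley_reisner_ideal K V \<Delta>"

text \<open>Here a complex is regarded as a complex on the set \<open>\<Union>\<Delta>\<close> of its own vertices, as is
  needed for links.\<close>

definition complete_intersection_complex :: "'k::field itself \<Rightarrow> 'v set set \<Rightarrow> bool" where
  "complete_intersection_complex K \<Delta> \<longleftrightarrow>
     generated_by_regular_seq (polynomial_ring K (\<Union>\<Delta>)) (stanley_reisner_ideal K (\<Union>\<Delta>) \<Delta>)"

end

theory Submission
  imports Defs
begin

text \<open>
  Everything is reduced to the combinatorics of the minimal nonfaces of \<open>\<Delta>\<close>.

  \<^item> The Stanley--Reisner ideal is generated by a regular sequence iff the minimal nonfaces are
    pairwise disjoint (\<open>generated_by_regular_seq_iff_disjoint_nonfaces\<close>). Pairwise coprime monomials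
    form a regular sequence. Conversely, let \<open>x\<^sub>1, \<dots>, x\<^sub>r\<close> be a regular sequence
    generating the ideal \<open>I\<close>. A relation \<open>\<Sum> a\<^sub>i x\<^sub>i = 0\<close> forces all \<open>a\<^sub>i\<close>
    into \<open>I\<close> (\<open>regular_seq_syzygy\<close>). Rewriting the trivial relation
    \<open>X\<^bsub>N - M\<^esub> X\<^bsub>M\<^esub> = X\<^bsub>M - N\<^esub> X\<^bsub>N\<^esub>\<close> between two minimal generators in terms of
    the \<open>x\<^sub>i\<close>, and the \<open>x\<^sub>i\<close> in terms of the minimal monomial generators, gives
    \<open>N - M \<notin> \<Delta>\<close>; since \<open>N\<close> is a minimal nonface, this means \<open>M \<inter> N = {}\<close>.

  \<^item> Under \<open>(S\<^sub>2)\<close>, every link of dimension at least \<open>1\<close> is connected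
    (\<open>connected_links_if_serre_S2\<close>). Localize at the prime ideal \<open>P\<close> generated by the
    variables outside a face \<open>F\<close>. If the vertices of the link of \<open>F\<close> split into two parts
    \<open>A\<close> and \<open>B\<close> without an edge between them, then the maximal ideal of the localization is
    the sum of two nonzero ideals with product zero, so its depth is at most \<open>1\<close>, whereas a link
    of dimension at least \<open>1\<close> makes the Krull dimension at least \<open>2\<close>. Connectedness of
    these links also implies that \<open>\<Delta>\<close> is pure (\<open>pure_if_connected_links\<close>).

  \<^item> If \<open>\<Delta>\<close> and its vertex links are connected and each vertex link has disjoint minimal
    nonfaces, then so has \<open>\<Delta>\<close> (\<open>disjoint_nonfaces_if_vertex_links\<close>). For two
    minimal nonfaces with at least three elements this is a local argument in the links of their
    vertices. Two nonadjacent vertices turn out to have a common neighbour and the same link, which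
    settles the case of a minimal nonface with two elements.

  Condition (2) now implies (1) by induction on the dimension, passing to vertex links. For (3)
  implies (2), purity shows that a face whose link is one-dimensional has dimension
  \<open>dim \<Delta> - 2\<close>, so it contains a vertex of \<open>W\<close>, and its link is a link in a vertex
  link with disjoint minimal nonfaces. Finally, disjointness of minimal nonfaces passes to links
  (\<open>disjoint_nonfaces_link\<close>), so (1) implies (2), and also (3) with \<open>W = V\<close>, because
  \<open>dim \<Delta> \<ge> 2\<close>.
\<close>

section \<open>Minimal nonfaces, links and connectedness\<close>

text \<open>A finite simplicial complex on the set \<open>\<Union>\<Delta>\<close> of its own vertices.\<close>

definition finite_complex :: "'v set set \<Rightarrow> bool" where
  "finite_complex \<Delta> \<longleftrightarrow> finite (\<Union>\<Delta>) \<and> {} \<in> \<Delta> \<and> (\<forall>F\<in>\<Delta>. \<forall>G. G \<subseteq> F \<longrightarrow> G \<in> \<Delta>)"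

text \<open>Only sets of vertices of \<open>\<Delta>\<close> count, so a vertex outside \<open>\<Delta>\<close> is not a nonface.\<close>

definition minimal_nonface :: "'v set set \<Rightarrow> 'v set \<Rightarrow> bool" where
  "minimal_nonface \<Delta> N \<longleftrightarrow> N \<subseteq> \<Union>\<Delta> \<and> N \<notin> \<Delta> \<and> (\<forall>G. G \<subset> N \<longrightarrow> G \<in> \<Delta>)"

text \<open>The combinatorial form of being a complete intersection complex.\<close>

definition disjoint_nonfaces :: "'v set set \<Rightarrow> bool" where
  "disjoint_nonfaces \<Delta> \<longleftrightarrow>
     (\<forall>M N. minimal_nonface \<Delta> M \<longrightarrow> minimal_nonface \<Delta> N \<longrightarrow> M \<noteq> N \<longrightarrow> M \<inter> N = {})"

text \<open>Connectedness of the graph of vertices and edges: a nonempty set of vertices that is closed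
  under adjacency contains all vertices. The complex \<open>{{}}\<close> is connected in this sense.\<close>

definition connected_complex :: "'v set set \<Rightarrow> bool" where
  "connected_complex \<Delta> \<longleftrightarrow>
     (\<forall>A\<subseteq>\<Union>\<Delta>. A \<noteq> {} \<longrightarrow> (\<forall>a\<in>A. \<forall>b. {a, b} \<in> \<Delta> \<longrightarrow> b \<in> A) \<longrightarrow> A = \<Union>\<Delta>)"

text \<open>Taking the empty face, this includes connectedness of \<open>\<Delta>\<close> itself if its dimension is at
  least \<open>1\<close>.\<close>

definition connected_links :: "'v set set \<Rightarrow> bool" where
  "connected_links \<Delta> \<longleftrightarrow>
     (\<forall>F\<in>\<Delta>. 1 \<le> complex_dim (link \<Delta> F) \<longrightarrow> connected_complex (link \<Delta> F))"

lemma finite_complex_simplicial_complex: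
  assumes "simplicial_complex V \<Delta>" "finite V"
  shows "finite_complex \<Delta>" and "\<Union>\<Delta> = V"
proof -
  show "\<Union>\<Delta> = V"
    using assms unfolding simplicial_complex_def by blast
  then show "finite_complex \<Delta>"
    using assms unfolding simplicial_complex_def finite_complex_def by blast
qed

context
  fixes \<Delta> :: "'v set set"
  assumes cpx: "finite_complex \<Delta>"
begin

lemma face_subset: "F \<in> \<Delta> \<Longrightarrow> G \<subseteq> F \<Longrightarrow> G \<in> \<Delta>"
  using cpx unfolding finite_complex_def by blast

lemma finite_face: "F \<in> \<Delta> \<Longrightarrow> finite F"
  using cpx unfolding finite_complex_def by (meson Union_upper finite_subset)

lemma finite_faces: "finite \<Delta>"
  using cpx unfolding finite_complex_def by (simp add: finite_UnionD)

lemma link_iff: "G \<in> link \<Delta> F \<longleftrightarrow> G \<union> F \<in> \<Delta> \<and> G \<inter> F = {}"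
  unfolding link_def using face_subset by blast

lemma finite_complex_link: "F \<in> \<Delta> \<Longrightarrow> finite_complex (link \<Delta> F)"
proof -
  assume F: "F \<in> \<Delta>"
  have "\<Union>(link \<Delta> F) \<subseteq> \<Union>\<Delta>"
    unfolding link_def by blast
  then have "finite (\<Union>(link \<Delta> F))"
    using cpx unfolding finite_complex_def by (meson finite_subset)
  moreover have "{} \<in> link \<Delta> F" using F by (simp add: link_iff)
  moreover have "G \<in> link \<Delta> F" if "H \<in> link \<Delta> F" "G \<subseteq> H" for G H
    using that face_subset[of "H \<union> F" "G \<union> F"] unfolding link_iff by blast
  ultimately show ?thesis unfolding finite_complex_def by blast
qed

lemma link_empty: "link \<Delta> {} = \<Delta>"
  by (auto simp: link_iff)

lemma link_link:
  assumes "F \<in> \<Delta>" "G \<in> link \<Delta> F"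
  shows "link (link \<Delta> F) G = link \<Delta> (F \<union> G)"
proof -
  have "H \<in> link (link \<Delta> F) G \<longleftrightarrow> H \<in> link \<Delta> (F \<union> G)" for H
  proof -
    have eq: "H \<union> G \<union> F = H \<union> (F \<union> G)" by blast
    have "H \<union> (F \<union> G) \<in> \<Delta> \<Longrightarrow> H \<union> F \<in> \<Delta>" by (erule face_subset) blast
    moreover have "G \<inter> F = {}" using assms(2) by (simp add: link_iff)
    ultimately show ?thesis
      unfolding link_def[of "link \<Delta> F"] mem_Collect_eq link_iff eq
      by (simp add: Int_Un_distrib Int_Un_distrib2) blast
  qed
  then show ?thesis by blast
qed

lemma face_dim_le: "F \<in> \<Delta> \<Longrightarrow> face_dim F \<le> complex_dim \<Delta>"
  unfolding complex_dim_def using finite_faces by simp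

lemma max_face: "\<exists>F\<in>\<Delta>. face_dim F = complex_dim \<Delta>"
proof -
  have "\<Delta> \<noteq> {}" using cpx unfolding finite_complex_def by blast
  then have "complex_dim \<Delta> \<in> face_dim ` \<Delta>"
    unfolding complex_dim_def using finite_faces by (intro Max_in) auto
  then show ?thesis by auto
qed

lemma complex_dim_link:
  assumes "F \<subseteq> G" "G \<in> \<Delta>" "face_dim G = complex_dim \<Delta>"
  shows "complex_dim (link \<Delta> F) = complex_dim \<Delta> - int (card F)"
proof -
  have F: "F \<in> \<Delta>" using assms face_subset by blast
  have fin: "finite G" "finite F" using assms finite_face F by blast+
  have lnk: "finite_complex (link \<Delta> F)" by (rule finite_complex_link[OF F])
  have "G - F \<in> link \<Delta> F"
    using assms by (auto simp: link_iff Un_absorb2)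
  moreover have "face_dim (G - F) = complex_dim \<Delta> - int (card F)"
    using fin assms by (simp add: face_dim_def card_Diff_subset card_mono of_nat_diff flip: assms(3))
  ultimately have ge: "complex_dim \<Delta> - int (card F) \<in> face_dim ` link \<Delta> F" by force
  have le: "face_dim H \<le> complex_dim \<Delta> - int (card F)" if "H \<in> link \<Delta> F" for H
  proof -
    have H: "H \<union> F \<in> \<Delta>" "H \<inter> F = {}" using that by (auto simp: link_iff)
    have "face_dim H + int (card F) = face_dim (H \<union> F)"
      using H finite_face[OF H(1)] by (simp add: face_dim_def card_Un_disjoint)
    then show ?thesis using face_dim_le[OF H(1)] by linarith
  qed
  have "finite (link \<Delta> F)" using finite_faces unfolding link_def by simp
  then show ?thesis
    unfolding complex_dim_def[of "link \<Delta> F"] using ge le by (intro Max_eqI) auto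
qed

lemma vertex_iff: "v \<in> \<Union>\<Delta> \<longleftrightarrow> {v} \<in> \<Delta>"
  by (auto intro: face_subset)

lemma link_vertex_iff: "v \<in> \<Union>(link \<Delta> {x}) \<longleftrightarrow> v \<noteq> x \<and> {x, v} \<in> \<Delta>"
proof
  assume "v \<in> \<Union>(link \<Delta> {x})"
  then obtain G where G: "v \<in> G" "G \<in> link \<Delta> {x}" by blast
  then have "G \<union> {x} \<in> \<Delta>" "G \<inter> {x} = {}" unfolding link_iff by blast+
  then show "v \<noteq> x \<and> {x, v} \<in> \<Delta>" using G(1) face_subset[of "G \<union> {x}" "{x, v}"] by blast
next
  assume "v \<noteq> x \<and> {x, v} \<in> \<Delta>"
  then have "{v} \<in> link \<Delta> {x}" by (auto simp: link_iff insert_commute)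
  then show "v \<in> \<Union>(link \<Delta> {x})" by blast
qed

lemma minimal_nonface_exists:
  assumes "N \<subseteq> \<Union>\<Delta>" "N \<notin> \<Delta>"
  shows "\<exists>M\<subseteq>N. minimal_nonface \<Delta> M"
proof -
  have fin: "finite N" using assms(1) cpx unfolding finite_complex_def by (meson finite_subset)
  have "finite {M. M \<subseteq> N \<and> M \<notin> \<Delta>}"
    using fin by simp
  moreover have "N \<in> {M. M \<subseteq> N \<and> M \<notin> \<Delta>}" using assms by simp
  ultimately obtain M where M: "M \<in> {M. M \<subseteq> N \<and> M \<notin> \<Delta>}"
      "\<forall>L\<in>{M. M \<subseteq> N \<and> M \<notin> \<Delta>}. L \<subseteq> M \<longrightarrow> M = L"
    using finite_has_minimal2[of "{M. M \<subseteq> N \<and> M \<notin> \<Delta>}" N] by blast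
  have "G \<in> \<Delta>" if "G \<subset> M" for G
  proof (rule ccontr)
    assume "G \<notin> \<Delta>"
    then have "G \<in> {M. M \<subseteq> N \<and> M \<notin> \<Delta>}" using that M(1) by blast
    then show False using M(2) that by blast
  qed
  moreover have "M \<subseteq> N" "M \<notin> \<Delta>" using M(1) by blast+
  ultimately show ?thesis using assms(1) unfolding minimal_nonface_def by (intro exI[of _ M]) auto
qed

lemma connected_links_link:
  assumes "connected_links \<Delta>" "F \<in> \<Delta>"
  shows "connected_links (link \<Delta> F)"
  unfolding connected_links_def
proof (intro ballI impI)
  fix G assume G: "G \<in> link \<Delta> F" "1 \<le> complex_dim (link (link \<Delta> F) G)"
  have "F \<union> G \<in> \<Delta>" using G by (auto simp: link_iff Un_commute)
  then show "connected_complex (link (link \<Delta> F) G)"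
    using G assms link_link unfolding connected_links_def by metis
qed

lemma disjoint_nonfaces_link:
  assumes "disjoint_nonfaces \<Delta>" "F \<in> \<Delta>"
  shows "disjoint_nonfaces (link \<Delta> F)"
proof -
  have *: "\<exists>N. minimal_nonface \<Delta> N \<and> L = N - F" if L: "minimal_nonface (link \<Delta> F) L" for L
  proof -
    have sub: "L \<subseteq> \<Union>(link \<Delta> F)" and nf: "L \<notin> link \<Delta> F"
      and min: "\<And>G. G \<subset> L \<Longrightarrow> G \<in> link \<Delta> F"
      using L unfolding minimal_nonface_def by blast+
    have disj: "L \<inter> F = {}" using sub unfolding link_def by blast
    have "L \<union> F \<subseteq> \<Union>\<Delta>" using sub assms(2) unfolding link_def by blast
    moreover have "L \<union> F \<notin> \<Delta>" using nf disj by (auto simp: link_iff)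
    ultimately obtain N where N: "N \<subseteq> L \<union> F" "minimal_nonface \<Delta> N"
      using minimal_nonface_exists by blast
    have "N - F \<notin> link \<Delta> F"
    proof
      assume "N - F \<in> link \<Delta> F"
      then have "N - F \<union> F \<in> \<Delta>" by (auto simp: link_iff)
      then show False using N(2) face_subset unfolding minimal_nonface_def by blast
    qed
    moreover have "N - F \<subseteq> L" using N(1) by blast
    ultimately have "L = N - F" using min[of "N - F"] by blast
    then show ?thesis using N by blast
  qed
  show ?thesis
    unfolding disjoint_nonfaces_def
  proof (intro allI impI)
    fix L L' assume L: "minimal_nonface (link \<Delta> F) L" "minimal_nonface (link \<Delta> F) L'" "L \<noteq> L'"
    obtain N N' where N: "minimal_nonface \<Delta> N" "L = N - F" "minimal_nonface \<Delta> N'" "L' = N' - F"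
      using *[OF L(1)] *[OF L(2)] by blast
    then have "N \<inter> N' = {}" using assms(1) L(3) unfolding disjoint_nonfaces_def by auto
    then show "L \<inter> L' = {}" using N by blast
  qed
qed

text \<open>Passing to the link of a vertex removes it from a minimal nonface, except that a
  two-element nonface \<open>{x, y}\<close> is lost: \<open>y\<close> is not a vertex of the link of \<open>x\<close>.\<close>

lemma minimal_nonface_link:
  assumes "minimal_nonface \<Delta> N" "x \<in> N" "\<And>y. N \<noteq> {x, y}"
  shows "minimal_nonface (link \<Delta> {x}) (N - {x})"
  unfolding minimal_nonface_def
proof (intro conjI allI impI)
  have N: "N \<subseteq> \<Union>\<Delta>" "N \<notin> \<Delta>" "\<And>G. G \<subset> N \<Longrightarrow> G \<in> \<Delta>"
    using assms(1) unfolding minimal_nonface_def by blast+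
  show "N - {x} \<subseteq> \<Union>(link \<Delta> {x})"
  proof
    fix y assume y: "y \<in> N - {x}"
    then have "{x, y} \<subset> N" using assms by blast
    then show "y \<in> \<Union>(link \<Delta> {x})" using y N(3) by (simp only: link_vertex_iff) blast
  qed
  show "N - {x} \<notin> link \<Delta> {x}"
    using N(2) assms(2) by (simp add: link_iff insert_absorb)
  fix G assume "G \<subset> N - {x}"
  then have "G \<union> {x} \<subset> N" "G \<inter> {x} = {}" using assms(2) by blast+
  then show "G \<in> link \<Delta> {x}" using N(3) by (simp only: link_iff)
qed

lemma minimal_nonface_link_pair:
  assumes "{x, w} \<in> \<Delta>" "{y, w} \<in> \<Delta>" "{x, y} \<notin> \<Delta>"
  shows "minimal_nonface (link \<Delta> {w}) {x, y}"
  unfolding minimal_nonface_def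
proof (intro conjI allI impI)
  have ne: "x \<noteq> w" "y \<noteq> w" "x \<noteq> y"
    using assms face_subset[OF assms(1), of "{x}"] by (metis insert_commute, blast, auto)
  have "x \<in> \<Union>(link \<Delta> {w})" "y \<in> \<Union>(link \<Delta> {w})"
    using assms ne unfolding link_vertex_iff by (auto simp: insert_commute)
  then show "{x, y} \<subseteq> \<Union>(link \<Delta> {w})" by blast
  show "{x, y} \<notin> link \<Delta> {w}" using assms(3) unfolding link_def by blast
  fix G assume "G \<subset> {x, y}"
  then have "G = {} \<or> G = {x} \<or> G = {y}" by blast
  moreover have "{} \<in> link \<Delta> {w}" using face_subset[OF assms(1), of "{w}"] by (simp add: link_iff)
  moreover have "{x} \<in> link \<Delta> {w}" "{y} \<in> link \<Delta> {w}" using ne assms by (auto simp: link_iff insert_commute)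
  ultimately show "G \<in> link \<Delta> {w}" by metis
qed

end

section \<open>Purity\<close>

text \<open>By induction on the dimension: the vertices of faces of maximal dimension are closed under
  adjacency, because the link of such a vertex is pure of dimension one less.\<close>

lemma pure_if_connected_links:
  assumes "finite_complex \<Delta>" "connected_links \<Delta>" "F \<in> \<Delta>"
  shows "\<exists>G\<in>\<Delta>. F \<subseteq> G \<and> face_dim G = complex_dim \<Delta>"
  using assms
proof (induction "nat (complex_dim \<Delta>)" arbitrary: \<Delta> F rule: less_induct)
  case less
  note cpx = less.prems(1)
  obtain M where M: "M \<in> \<Delta>" "face_dim M = complex_dim \<Delta>" using max_face[OF cpx] by blast
  have fin: "finite F" using finite_face[OF cpx] less.prems(3) .
  show ?case
  proof (cases "F = {}")
    case True
    then show ?thesis using M by blast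
  next
    case False
    then have Fcard: "card F \<ge> 1" using fin by (simp add: Suc_leI card_gt_0_iff)
    then have "complex_dim \<Delta> \<ge> 0" using face_dim_le[OF cpx less.prems(3)] by (simp add: face_dim_def)
    show ?thesis
    proof (cases "complex_dim \<Delta> = 0")
      case True
      then show ?thesis
        using face_dim_le[OF cpx less.prems(3)] Fcard less.prems(3) by (auto simp: face_dim_def)
    next
      case False
      then have dim: "complex_dim \<Delta> \<ge> 1" using \<open>complex_dim \<Delta> \<ge> 0\<close> by linarith
      then have conn: "connected_complex \<Delta>"
        using less.prems(2) cpx link_empty[OF cpx]
        unfolding connected_links_def finite_complex_def by metis
      define A where "A = {v. \<exists>G\<in>\<Delta>. v \<in> G \<and> face_dim G = complex_dim \<Delta>}"
      have extend: "\<exists>G\<in>\<Delta>. H \<subseteq> G \<and> face_dim G = complex_dim \<Delta>"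
        if a: "a \<in> A" "a \<in> H" "H \<in> \<Delta>" for a H
      proof -
        obtain G where G: "G \<in> \<Delta>" "a \<in> G" "face_dim G = complex_dim \<Delta>"
          using a unfolding A_def by blast
        have a': "{a} \<in> \<Delta>" using a face_subset[OF cpx a(3)] by blast
        have d: "complex_dim (link \<Delta> {a}) = complex_dim \<Delta> - 1"
          using complex_dim_link[OF cpx _ G(1,3), of "{a}"] G by simp
        have "H - {a} \<in> link \<Delta> {a}"
          using a by (simp add: link_iff[OF cpx] insert_absorb)
        then obtain L where L: "L \<in> link \<Delta> {a}" "H - {a} \<subseteq> L"
            "face_dim L = complex_dim \<Delta> - 1"
          using less.hyps[of "link \<Delta> {a}" "H - {a}"] d dim finite_complex_link[OF cpx a']
            connected_links_link[OF cpx less.prems(2) a'] by auto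
        have L': "insert a L \<in> \<Delta>" "a \<notin> L" using L(1) by (auto simp: link_iff[OF cpx])
        have "face_dim (insert a L) = complex_dim \<Delta>"
          using L' L(3) finite_face[OF cpx L'(1)] by (simp add: face_dim_def)
        then show ?thesis using L' L(2) by (intro bexI[of _ "insert a L"]) auto
      qed
      have "A = \<Union>\<Delta>"
      proof (rule conn[unfolded connected_complex_def, rule_format])
        show "A \<subseteq> \<Union>\<Delta>" unfolding A_def by blast
        have "M \<noteq> {}" using M dim by (auto simp: face_dim_def)
        then show "A \<noteq> {}" using M unfolding A_def by blast
        fix a b assume "a \<in> A" "{a, b} \<in> \<Delta>"
        then show "b \<in> A" using extend[of a "{a, b}"] unfolding A_def by blast
      qed
      then show ?thesis using extend \<open>F \<noteq> {}\<close> less.prems(3) by blast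
    qed
  qed
qed

lemma complex_dim_link_pure:
  assumes "finite_complex \<Delta>" "connected_links \<Delta>" "F \<in> \<Delta>"
  shows "complex_dim (link \<Delta> F) = complex_dim \<Delta> - int (card F)"
  using pure_if_connected_links[OF assms] complex_dim_link[OF assms(1)] by blast

section \<open>From the links to the complex\<close>

context
  fixes \<Delta> :: "'v set set"
  assumes cpx: "finite_complex \<Delta>"
    and disj_link: "\<And>x. x \<in> \<Union>\<Delta> \<Longrightarrow> disjoint_nonfaces (link \<Delta> {x})"
begin

lemma link_minimal_nonfaces_eq:
  assumes "x \<in> \<Union>\<Delta>" "minimal_nonface (link \<Delta> {x}) M" "minimal_nonface (link \<Delta> {x}) N"
    "z \<in> M" "z \<in> N"
  shows "M = N"
  using disj_link[OF assms(1)] assms unfolding disjoint_nonfaces_def by blast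

text \<open>For a set \<open>M\<close> containing \<open>x\<close>, not being of the form \<open>{x, y}\<close>, with \<open>y = x\<close> included,
  means having at least three elements.\<close>

lemma large_minimal_nonfaces_eq:
  assumes M: "minimal_nonface \<Delta> M" "\<And>y. M \<noteq> {x, y}" "x \<in> M"
    and N: "minimal_nonface \<Delta> N" "\<And>y. N \<noteq> {x, y}" "x \<in> N"
  shows "M = N"
proof (rule ccontr)
  assume "M \<noteq> N"
  have Mx: "minimal_nonface (link \<Delta> {x}) (M - {x})" using minimal_nonface_link[OF cpx M(1,3,2)] .
  have Nx: "minimal_nonface (link \<Delta> {x}) (N - {x})" using minimal_nonface_link[OF cpx N(1,3,2)] .
  have xV: "x \<in> \<Union>\<Delta>" using M unfolding minimal_nonface_def by blast
  have int: "M \<inter> N = {x}"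
    using link_minimal_nonfaces_eq[OF xV Mx Nx] \<open>M \<noteq> N\<close> M(3) N(3) by blast
  obtain y where y: "y \<in> M" "y \<noteq> x" using M(2)[of x] M(3) by blast
  have M2: "\<And>z. M \<noteq> {y, z}" using M(2) M(3) y by blast
  have yV: "y \<in> \<Union>\<Delta>" using M y unfolding minimal_nonface_def by blast
  have yN: "y \<notin> N" using int y by blast
  have My: "minimal_nonface (link \<Delta> {y}) (M - {y})" using minimal_nonface_link[OF cpx M(1) y(1) M2] .
  \<comment> \<open>Proper subsets of \<open>N - {x}\<close> join with \<open>{x, y}\<close> to a face.\<close>
  have join: "insert x (insert y L) \<in> \<Delta>" if "L \<subset> N - {x}" for L
  proof (rule ccontr)
    assume nf: "insert x (insert y L) \<notin> \<Delta>"
    have "y \<in> \<Union>(link \<Delta> {x})" "L \<subseteq> \<Union>(link \<Delta> {x})"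
      using Mx Nx y that unfolding minimal_nonface_def by blast+
    moreover have "insert y L \<notin> link \<Delta> {x}" using nf by (simp add: link_iff[OF cpx])
    ultimately obtain K where K: "K \<subseteq> insert y L" "minimal_nonface (link \<Delta> {x}) K"
      using minimal_nonface_exists[OF finite_complex_link[OF cpx]] xV vertex_iff[OF cpx]
      by (metis insert_subset)
    show False
    proof (cases "y \<in> K")
      case True
      then have "K = M - {x}" using link_minimal_nonfaces_eq[OF xV K(2) Mx] y by blast
      moreover have "L \<inter> M = {}" using that int by blast
      ultimately have "M - {x} \<subseteq> {y}" using K(1) by blast
      then show False using M(2)[of y] M(3) y(1) by blast
    next
      case False
      then have "K \<subset> N - {x}" using K(1) that by blast
      then show False using K(2) Nx unfolding minimal_nonface_def by blast
    qed
  qed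
  have edge: "{y, z} \<in> \<Delta>" if "z \<in> N" for z
  proof (cases "z = x")
    case True
    then show ?thesis using join[of "{}"] N(2)[of x] N(3) by (auto simp: insert_commute)
  next
    case False
    then have "{z} \<subset> N - {x}" using that N(2)[of z] N(3) by blast
    from join[OF this] show ?thesis by (rule face_subset[OF cpx]) blast
  qed
  \<comment> \<open>So \<open>N\<close> is a nonface of the link of \<open>y\<close>. A minimal nonface \<open>K \<subseteq> N\<close> of that link avoids
    \<open>x\<close>, as \<open>M - {y}\<close> is the only one containing \<open>x\<close>.\<close>
  have "N \<subseteq> \<Union>(link \<Delta> {y})" using edge yN link_vertex_iff[OF cpx, of _ y] by blast
  moreover have "N \<notin> link \<Delta> {y}" using N(1) unfolding minimal_nonface_def link_def by blast
  ultimately obtain K where K: "K \<subseteq> N" "minimal_nonface (link \<Delta> {y}) K"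
    using minimal_nonface_exists[OF finite_complex_link[OF cpx]] yV vertex_iff[OF cpx] by metis
  have xK: "x \<notin> K"
  proof
    assume "x \<in> K"
    then have "K = M - {y}" using link_minimal_nonfaces_eq[OF yV K(2) My] M(3) y by blast
    then have "M - {y} \<subseteq> {x}" using K(1) int by blast
    then show False using M(2)[of y] M(3) y(1) by blast
  qed
  have "insert y K \<notin> \<Delta>"
    using K yN unfolding minimal_nonface_def by (auto simp: link_iff[OF cpx])
  then have KN: "K = N - {x}"
    using join[of K] K(1) xK face_subset[OF cpx, of "insert x (insert y K)" "insert y K"] by blast
  \<comment> \<open>Exchanging \<open>x\<close> for \<open>y\<close> in \<open>N\<close> gives another minimal nonface, since \<open>K = N - {x}\<close>.\<close>
  have N': "minimal_nonface \<Delta> (insert y (N - {x}))"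
    unfolding minimal_nonface_def
  proof (intro conjI allI impI)
    show "insert y (N - {x}) \<subseteq> \<Union>\<Delta>" using yV N(1) unfolding minimal_nonface_def by blast
    show "insert y (N - {x}) \<notin> \<Delta>" using \<open>insert y K \<notin> \<Delta>\<close> KN by simp
    fix G assume G: "G \<subset> insert y (N - {x})"
    show "G \<in> \<Delta>"
    proof (cases "y \<in> G")
      case True
      then have "G - {y} \<subset> N - {x}" using G by blast
      from join[OF this] show ?thesis by (rule face_subset[OF cpx]) blast
    next
      case False
      then have "G \<subset> N" using G N(3) by blast
      then show ?thesis using N(1) unfolding minimal_nonface_def by blast
    qed
  qed
  \<comment> \<open>In the link of a third vertex \<open>z\<close>, these two nonfaces still share a vertex \<open>t\<close>.\<close>
  obtain z where z: "z \<in> N" "z \<noteq> x" using N(2)[of x] N(3) by blast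
  obtain t where t: "t \<in> N" "t \<noteq> x" "t \<noteq> z" using N(2)[of z] N(3) z by blast
  have zV: "z \<in> \<Union>\<Delta>" using N z unfolding minimal_nonface_def by blast
  have "minimal_nonface (link \<Delta> {z}) (N - {z})"
    using minimal_nonface_link[OF cpx N(1) z(1)] t z N(3) by blast
  moreover have "minimal_nonface (link \<Delta> {z}) (insert y (N - {x}) - {z})"
  proof (rule minimal_nonface_link[OF cpx N'])
    show "z \<in> insert y (N - {x})" using z by blast
    fix u
    show "insert y (N - {x}) \<noteq> {z, u}"
    proof
      assume eq: "insert y (N - {x}) = {z, u}"
      have "t \<in> {z, u}" "y \<in> {z, u}" unfolding eq[symmetric] using t by blast+
      then show False using t z yN by auto
    qed
  qed
  ultimately have "N - {z} = insert y (N - {x}) - {z}"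
    using link_minimal_nonfaces_eq[OF zV, of _ _ t] t by blast
  then show False using yN z y by blast
qed

text \<open>In the link of a common neighbour \<open>w\<close> of two nonadjacent vertices \<open>x\<close> and \<open>y\<close>, the set
  \<open>{x, y}\<close> is a minimal nonface, so no other minimal nonface of that link involves \<open>y\<close>.\<close>

lemma join_swap:
  assumes "{x, w} \<in> \<Delta>" "{y, w} \<in> \<Delta>" "{x, y} \<notin> \<Delta>" "insert x G \<in> \<Delta>" "w \<in> G" "x \<notin> G"
  shows "insert y G \<in> \<Delta>"
proof (rule ccontr)
  assume nf: "insert y G \<notin> \<Delta>"
  have wV: "w \<in> \<Union>\<Delta>" using assms by blast
  have ne: "y \<noteq> w" "x \<noteq> y" using assms face_subset[OF cpx assms(1), of "{x}"] by (blast, auto)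
  have "{v, w} \<in> \<Delta>" if "v \<in> G" for v using face_subset[OF cpx assms(4), of "{v, w}"] that assms(5) by blast
  then have "insert y (G - {w}) \<subseteq> \<Union>(link \<Delta> {w})"
    using ne assms link_vertex_iff[OF cpx, of _ w] by (auto simp: insert_commute)
  moreover have "insert y (G - {w}) \<notin> link \<Delta> {w}"
  proof -
    have eq: "insert y (G - {w}) \<union> {w} = insert y G" using assms(5) by blast
    show ?thesis unfolding link_iff[OF cpx] eq using nf by blast
  qed
  ultimately obtain K where K: "K \<subseteq> insert y (G - {w})" "minimal_nonface (link \<Delta> {w}) K"
    using minimal_nonface_exists[OF finite_complex_link[OF cpx]] wV vertex_iff[OF cpx] by metis
  have "y \<in> K"
  proof (rule ccontr)
    assume "y \<notin> K"
    then have "K \<subseteq> G - {w}" using K(1) by blast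
    then have "K \<union> {w} \<subseteq> insert x G" "K \<inter> {w} = {}" using assms(5) by blast+
    then have "K \<in> link \<Delta> {w}" using assms(4) face_subset[OF cpx] by (auto simp: link_iff[OF cpx])
    then show False using K(2) unfolding minimal_nonface_def by blast
  qed
  then have "K = {x, y}"
    using link_minimal_nonfaces_eq[OF wV K(2) minimal_nonface_link_pair[OF cpx assms(1-3)]] by blast
  then show False using K(1) assms(6) ne by blast
qed

text \<open>The common neighbours of \<open>x\<close> and \<open>y\<close> are closed under adjacency in the link of \<open>x\<close>, which
  is connected.\<close>

lemma link_subset_if_common_neighbour:
  assumes conn: "connected_complex (link \<Delta> {x})"
    and "{x, w} \<in> \<Delta>" "{y, w} \<in> \<Delta>" "{x, y} \<notin> \<Delta>"
  shows "link \<Delta> {x} \<subseteq> link \<Delta> {y}"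
proof -
  define C where "C = {c \<in> \<Union>(link \<Delta> {x}). {y, c} \<in> \<Delta>}"
  have "w \<noteq> x" using assms by (auto simp: insert_commute)
  have CV: "C = \<Union>(link \<Delta> {x})"
  proof (rule conn[unfolded connected_complex_def, rule_format])
    show "C \<subseteq> \<Union>(link \<Delta> {x})" unfolding C_def by blast
    have "w \<in> C" unfolding C_def using assms \<open>w \<noteq> x\<close> link_vertex_iff[OF cpx] by blast
    then show "C \<noteq> {}" by blast
    fix a b assume a: "a \<in> C" and ab: "{a, b} \<in> link \<Delta> {x}"
    have "{x, a} \<in> \<Delta>" "{y, a} \<in> \<Delta>" using a link_vertex_iff[OF cpx] unfolding C_def by blast+
    moreover have "insert x {a, b} \<in> \<Delta>" "x \<notin> {a, b}" using ab by (auto simp: link_iff[OF cpx])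
    ultimately have "insert y {a, b} \<in> \<Delta>" using join_swap[of x a y "{a, b}"] assms(4) by blast
    then have "{y, b} \<in> \<Delta>" by (rule face_subset[OF cpx]) blast
    then show "b \<in> C" unfolding C_def using ab by blast
  qed
  show ?thesis
  proof
    fix G assume G: "G \<in> link \<Delta> {x}"
    then have xG: "insert x G \<in> \<Delta>" "x \<notin> G" by (auto simp: link_iff[OF cpx])
    have yG: "y \<notin> G" using xG(1) assms(4) face_subset[OF cpx, of "insert x G" "{x, y}"] by blast
    show "G \<in> link \<Delta> {y}"
    proof (cases "G = {}")
      case True
      then show ?thesis using assms(3) face_subset[OF cpx, of "{y, w}" "{y}"] by (auto simp: link_iff[OF cpx])
    next
      case False
      then obtain c where c: "c \<in> G" by blast
      then have "c \<in> C" using CV G by blast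
      then have "{x, c} \<in> \<Delta>" "{y, c} \<in> \<Delta>" using link_vertex_iff[OF cpx] unfolding C_def by blast+
      then have "insert y G \<in> \<Delta>" using join_swap c xG assms(4) by blast
      then show ?thesis using yG by (simp add: link_iff[OF cpx])
    qed
  qed
qed

theorem disjoint_nonfaces_if_vertex_links:
  assumes conn: "connected_complex \<Delta>"
    and conn_link: "\<And>x. x \<in> \<Union>\<Delta> \<Longrightarrow> connected_complex (link \<Delta> {x})"
  shows "disjoint_nonfaces \<Delta>"
proof -
  have same: "link \<Delta> {x} = link \<Delta> {y}" if "{x, w} \<in> \<Delta>" "{y, w} \<in> \<Delta>" "{x, y} \<notin> \<Delta>" for x y w
  proof -
    have "x \<in> \<Union>\<Delta>" "y \<in> \<Union>\<Delta>" "{y, x} \<notin> \<Delta>" using that by (auto simp: insert_commute)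
    then show ?thesis using that link_subset_if_common_neighbour conn_link by (meson subset_antisym)
  qed
  \<comment> \<open>Any two vertices are equal, adjacent, or have a common neighbour; \<open>w\<close> may be one of them.\<close>
  have diam: "\<exists>w. {x, w} \<in> \<Delta> \<and> {y, w} \<in> \<Delta>" if xy: "x \<in> \<Union>\<Delta>" "y \<in> \<Union>\<Delta>" for x y
  proof -
    define A where "A = {z \<in> \<Union>\<Delta>. \<exists>w. {x, w} \<in> \<Delta> \<and> {z, w} \<in> \<Delta>}"
    have "A = \<Union>\<Delta>"
    proof (rule conn[unfolded connected_complex_def, rule_format])
      show "A \<subseteq> \<Union>\<Delta>" unfolding A_def by blast
      have "{x, x} \<in> \<Delta>" using xy vertex_iff[OF cpx] by simp
      then show "A \<noteq> {}" unfolding A_def using xy by blast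
      fix a b assume "a \<in> A" and ab: "{a, b} \<in> \<Delta>"
      then obtain w where w: "{x, w} \<in> \<Delta>" "{a, w} \<in> \<Delta>" unfolding A_def by blast
      have "{b} \<in> \<Delta>" by (rule face_subset[OF cpx ab]) simp
      then have b: "b \<in> \<Union>\<Delta>" "{b, b} \<in> \<Delta>" "{b, a} \<in> \<Delta>"
        using ab vertex_iff[OF cpx] by (simp_all add: insert_commute)
      show "b \<in> A"
      proof (cases "{x, a} \<in> \<Delta>")
        case True
        then show ?thesis unfolding A_def using b by blast
      next
        case False
        then have eq: "link \<Delta> {x} = link \<Delta> {a}" using same w by blast
        show ?thesis
        proof (cases "b = a")
          case True
          then show ?thesis using \<open>a \<in> A\<close> by simp
        next
          case False
          then have "{x, b} \<in> \<Delta>" using ab eq link_vertex_iff[OF cpx, of b] by metis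
          then show ?thesis unfolding A_def using b by blast
        qed
      qed
    qed
    then show ?thesis using xy unfolding A_def by blast
  qed
  \<comment> \<open>A two-element minimal nonface meets no other minimal nonface.\<close>
  have small: "N = {x, y}" if xy: "minimal_nonface \<Delta> {x, y}" and N: "minimal_nonface \<Delta> N" "x \<in> N" for x y N
  proof (rule ccontr)
    assume ne: "N \<noteq> {x, y}"
    have nf: "{x, y} \<notin> \<Delta>" and V: "x \<in> \<Union>\<Delta>" "y \<in> \<Union>\<Delta>"
      using xy unfolding minimal_nonface_def by blast+
    obtain w where w: "{x, w} \<in> \<Delta>" "{y, w} \<in> \<Delta>" using diam V by blast
    have eq: "link \<Delta> {x} = link \<Delta> {y}" using same w nf by blast
    have yN: "y \<notin> N"
    proof
      assume "y \<in> N"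
      then have "{x, y} \<subset> N" using N(2) ne by blast
      then show False using N(1) nf unfolding minimal_nonface_def by blast
    qed
    show False
    proof (cases "\<exists>z. N = {x, z}")
      case True
      then obtain z where z: "N = {x, z}" by blast
      have zV: "z \<in> \<Union>\<Delta>" and xz: "{x, z} \<notin> \<Delta>"
        using N z unfolding minimal_nonface_def by blast+
      have "x \<noteq> z" using xz V vertex_iff[OF cpx] by auto
      obtain u where u: "{x, u} \<in> \<Delta>" "{z, u} \<in> \<Delta>" using diam V zV by blast
      have "u \<noteq> x" using u xz by (auto simp: insert_commute)
      then have "{y, u} \<in> \<Delta>" using u(1) eq link_vertex_iff[OF cpx, of u] by metis
      then have "{x, y} = {x, z}"
        using link_minimal_nonfaces_eq[of u "{x, y}" "{x, z}" x] u
          minimal_nonface_link_pair[OF cpx _ _ nf] minimal_nonface_link_pair[OF cpx _ _ xz] by blast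
      then show False using z ne by simp
    next
      case False
      then obtain u where u: "u \<in> N" "u \<noteq> x" using N(2) by blast
      have "{x, u} \<subset> N" using u(1) N(2) False by blast
      then have xu: "{x, u} \<in> \<Delta>" using N(1) unfolding minimal_nonface_def by blast
      then have yu: "{y, u} \<in> \<Delta>" using u(2) eq link_vertex_iff[OF cpx, of u] by metis
      have "\<And>z. N \<noteq> {u, z}" using False u N(2) by blast
      then have "minimal_nonface (link \<Delta> {u}) (N - {u})" using minimal_nonface_link[OF cpx N(1) u(1)] by blast
      then have "{x, y} = N - {u}"
        using link_minimal_nonfaces_eq[of u "{x, y}" "N - {u}" x] xu u N(2)
          minimal_nonface_link_pair[OF cpx xu yu nf] by blast
      then show False using yN by blast
    qed
  qed
  show ?thesis
    unfolding disjoint_nonfaces_def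
  proof (intro allI impI)
    fix M N assume MN: "minimal_nonface \<Delta> M" "minimal_nonface \<Delta> N" "M \<noteq> N"
    show "M \<inter> N = {}"
    proof (rule ccontr)
      assume "M \<inter> N \<noteq> {}"
      then obtain x where x: "x \<in> M" "x \<in> N" by blast
      then show False using small large_minimal_nonfaces_eq MN by metis
    qed
  qed
qed

end

text \<open>Induction on the dimension; purity keeps the vertex links at dimension at least \<open>1\<close>.\<close>

theorem disjoint_nonfaces_if_one_dim_links:
  assumes "finite_complex \<Delta>" "connected_links \<Delta>" "1 \<le> complex_dim \<Delta>"
    and "\<And>F. F \<in> \<Delta> \<Longrightarrow> complex_dim (link \<Delta> F) = 1 \<Longrightarrow> disjoint_nonfaces (link \<Delta> F)"
  shows "disjoint_nonfaces \<Delta>"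
  using assms
proof (induction "nat (complex_dim \<Delta>)" arbitrary: \<Delta> rule: less_induct)
  case less
  note cpx = less.prems(1)
  have empty: "{} \<in> \<Delta>" using cpx unfolding finite_complex_def by blast
  show ?case
  proof (cases "complex_dim \<Delta> = 1")
    case True
    then show ?thesis using less.prems(4)[OF empty] by (simp add: link_empty[OF cpx])
  next
    case False
    then have dim: "2 \<le> complex_dim \<Delta>" using less.prems(3) by linarith
    have dimx: "complex_dim (link \<Delta> {x}) = complex_dim \<Delta> - 1" if "x \<in> \<Union>\<Delta>" for x
      using complex_dim_link_pure[OF cpx less.prems(2)] that vertex_iff[OF cpx] by fastforce
    show ?thesis
    proof (rule disjoint_nonfaces_if_vertex_links[OF cpx])
      show "connected_complex \<Delta>"
        using less.prems(2) empty dim link_empty[OF cpx] unfolding connected_links_def by fastforce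
    next
      fix x assume x: "x \<in> \<Union>\<Delta>"
      then have x': "{x} \<in> \<Delta>" using vertex_iff[OF cpx] by blast
      show "connected_complex (link \<Delta> {x})"
        using less.prems(2) x' dim dimx[OF x] unfolding connected_links_def by fastforce
      show "disjoint_nonfaces (link \<Delta> {x})"
      proof (rule less.hyps)
        show "nat (complex_dim (link \<Delta> {x})) < nat (complex_dim \<Delta>)"
          using dim dimx[OF x] by linarith
        show "finite_complex (link \<Delta> {x})" using finite_complex_link[OF cpx x'] .
        show "connected_links (link \<Delta> {x})" using connected_links_link[OF cpx less.prems(2) x'] .
        show "1 \<le> complex_dim (link \<Delta> {x})" using dim dimx[OF x] by linarith
        fix F assume F: "F \<in> link \<Delta> {x}" "complex_dim (link (link \<Delta> {x}) F) = 1"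
        have eq: "link (link \<Delta> {x}) F = link \<Delta> ({x} \<union> F)" using link_link[OF cpx x' F(1)] .
        have "{x} \<union> F \<in> \<Delta>" using F(1) link_iff[OF cpx] by (simp add: Un_commute)
        then show "disjoint_nonfaces (link (link \<Delta> {x}) F)"
          using less.prems(4) F(2) eq by metis
      qed
    qed
  qed
qed

text \<open>By purity, a face with one-dimensional link is too large to avoid \<open>W\<close>, so its link is a
  link in a vertex link.\<close>

lemma disjoint_nonfaces_one_dim_link:
  assumes cpx: "finite_complex \<Delta>" and conn: "connected_links \<Delta>"
    and W: "complex_dim (restriction \<Delta> (\<Union>\<Delta> - W)) \<le> complex_dim \<Delta> - 3"
    and disj: "\<And>x. x \<in> W \<Longrightarrow> disjoint_nonfaces (link \<Delta> {x})"
    and F: "F \<in> \<Delta>" "complex_dim (link \<Delta> F) = 1"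
  shows "disjoint_nonfaces (link \<Delta> F)"
proof -
  have "finite_complex (restriction \<Delta> (\<Union>\<Delta> - W))"
    using cpx unfolding finite_complex_def restriction_def by (auto intro: rev_finite_subset)
  moreover have "face_dim F > complex_dim \<Delta> - 3"
    using complex_dim_link_pure[OF cpx conn F(1)] F(2) by (simp add: face_dim_def)
  ultimately have "F \<notin> restriction \<Delta> (\<Union>\<Delta> - W)" using face_dim_le W by fastforce
  then obtain x where x: "x \<in> F" "x \<in> W" using F(1) unfolding restriction_def by blast
  have x': "{x} \<in> \<Delta>" using x F face_subset[OF cpx] by blast
  have Fx: "F - {x} \<in> link \<Delta> {x}" using F x by (simp add: link_iff[OF cpx] insert_absorb)
  have "link (link \<Delta> {x}) (F - {x}) = link \<Delta> F"
    using link_link[OF cpx x' Fx] x by (simp add: insert_absorb)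
  then show ?thesis
    using disjoint_nonfaces_link[OF finite_complex_link[OF cpx x'] disj[OF x(2)] Fx] by simp
qed

section \<open>Ideals of polynomial rings\<close>

lemma mem_polynomial_ring:
  "p \<in> carrier (polynomial_ring K V) \<longleftrightarrow> (\<forall>m\<in>Poly_Mapping.keys p. Poly_Mapping.keys m \<subseteq> V)"
  by (simp add: polynomial_ring_def)

lemma polynomial_ring_simps [simp]:
  "mult (polynomial_ring K V) = (*)" "one (polynomial_ring K V) = 1"
  "zero (polynomial_ring K V) = 0" "add (polynomial_ring K V) = (+)"
  by (simp_all add: polynomial_ring_def)

context
  fixes K :: "'k::field itself" and V :: "'v set"
begin

text \<open>The operations of \<open>PR\<close> are those of the type class, so ideals and linear combinations can be
  handled with class-level arithmetic and sums.\<close>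

abbreviation (input) "PR \<equiv> polynomial_ring K V"

lemma zero_in_PR: "0 \<in> carrier PR"
  by (simp add: mem_polynomial_ring)

lemma one_in_PR: "1 \<in> carrier PR"
  by (simp add: mem_polynomial_ring)

lemma single_in_PR: "Poly_Mapping.keys m \<subseteq> V \<Longrightarrow> Poly_Mapping.single m c \<in> carrier PR"
  by (simp add: mem_polynomial_ring)

lemma add_in_PR: "p \<in> carrier PR \<Longrightarrow> q \<in> carrier PR \<Longrightarrow> p + q \<in> carrier PR"
  using keys_add[of p q] unfolding mem_polynomial_ring by blast

lemma uminus_in_PR: "p \<in> carrier PR \<Longrightarrow> - p \<in> carrier PR"
  unfolding mem_polynomial_ring by (simp add: in_keys_iff)

lemma mult_in_PR:
  assumes "p \<in> carrier PR" "q \<in> carrier PR"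
  shows "p * q \<in> carrier PR"
  unfolding mem_polynomial_ring
proof
  fix m assume "m \<in> Poly_Mapping.keys (p * q)"
  then obtain a b where "m = a + b" "a \<in> Poly_Mapping.keys p" "b \<in> Poly_Mapping.keys q"
    using keys_mult[of p q] by blast
  then show "Poly_Mapping.keys m \<subseteq> V"
    using keys_add[of a b] assms unfolding mem_polynomial_ring by blast
qed

lemma sum_in_PR: "(\<And>i. i \<in> A \<Longrightarrow> f i \<in> carrier PR) \<Longrightarrow> sum f A \<in> carrier PR"
  by (induction A rule: infinite_finite_induct) (auto intro: zero_in_PR add_in_PR)

lemma cring_polynomial_ring: "cring PR"
proof (rule cringI)
  show "abelian_group PR"
  proof (rule abelian_groupI)
    fix p assume p: "p \<in> carrier PR"
    show "\<exists>q\<in>carrier PR. q \<oplus>\<^bsub>PR\<^esub> p = \<zero>\<^bsub>PR\<^esub>"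
      using uminus_in_PR[OF p] by (intro bexI[of _ "- p"]) simp_all
  qed (simp_all add: add_in_PR zero_in_PR ac_simps)
  show "comm_monoid PR"
    by (rule comm_monoidI) (simp_all add: mult_in_PR one_in_PR ac_simps)
qed (simp add: algebra_simps)

lemma ideal_polynomial_ringI:
  assumes "J \<subseteq> carrier PR" "0 \<in> J" "\<And>p q. p \<in> J \<Longrightarrow> q \<in> J \<Longrightarrow> p + q \<in> J"
    and "\<And>p c. p \<in> J \<Longrightarrow> c \<in> carrier PR \<Longrightarrow> c * p \<in> J"
  shows "ideal J PR"
proof -
  interpret cring PR by (rule cring_polynomial_ring)
  have neg: "- p \<in> J" if "p \<in> J" for p
    using assms(4)[OF that uminus_in_PR[OF one_in_PR]] by simp
  have "\<ominus>\<^bsub>PR\<^esub> p = - p" if "p \<in> J" for p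
  proof -
    have "- p \<oplus>\<^bsub>PR\<^esub> p = \<zero>\<^bsub>PR\<^esub>" by simp
    then show ?thesis
      using that neg assms(1) by (intro minus_equality) auto
  qed
  then have "inv\<^bsub>add_monoid PR\<^esub> p = - p" if "p \<in> J" for p
    using that unfolding a_inv_def by simp
  then have "subgroup J (add_monoid PR)"
    using assms neg by unfold_locales auto
  then show ?thesis
    by (rule idealI[OF ring_axioms]) (use assms in \<open>simp_all add: mult.commute\<close>)
qed

lemma ideal_polynomial_ringD:
  assumes "ideal J PR"
  shows "J \<subseteq> carrier PR" "0 \<in> J" "\<And>p q. p \<in> J \<Longrightarrow> q \<in> J \<Longrightarrow> p + q \<in> J"
    and "\<And>p c. p \<in> J \<Longrightarrow> c \<in> carrier PR \<Longrightarrow> c * p \<in> J"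
    and "\<And>f A. (\<And>i. i \<in> A \<Longrightarrow> f i \<in> J) \<Longrightarrow> sum f A \<in> J"
proof -
  have sub: "additive_subgroup J PR" by (rule ideal.axioms(1)[OF assms])
  show "J \<subseteq> carrier PR" by (rule additive_subgroup.a_subset[OF sub])
  show zero: "0 \<in> J" using additive_subgroup.zero_closed[OF sub] by simp
  show add: "p + q \<in> J" if "p \<in> J" "q \<in> J" for p q
    using additive_subgroup.a_closed[OF sub that] by simp
  show "c * p \<in> J" if "p \<in> J" "c \<in> carrier PR" for p c
    using ideal.I_l_closed[OF assms that] by simp
  show "(\<And>i. i \<in> A \<Longrightarrow> f i \<in> J) \<Longrightarrow> sum f A \<in> J" for f :: "'c \<Rightarrow> _" and A
    by (induction A rule: infinite_finite_induct) (auto intro: zero add)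
qed

lemma ideal_Idl: "G \<subseteq> carrier PR \<Longrightarrow> ideal (Idl\<^bsub>PR\<^esub> G) PR"
  using ring.genideal_ideal[OF cring.axioms(1)[OF cring_polynomial_ring]] .

lemma Idl_incl: "G \<subseteq> carrier PR \<Longrightarrow> G \<subseteq> Idl\<^bsub>PR\<^esub> G"
  using ring.genideal_self[OF cring.axioms(1)[OF cring_polynomial_ring]] .

lemma Idl_minimal: "ideal J PR \<Longrightarrow> G \<subseteq> J \<Longrightarrow> Idl\<^bsub>PR\<^esub> G \<subseteq> J"
  using ring.genideal_minimal[OF cring.axioms(1)[OF cring_polynomial_ring]] .

lemma mem_Idl_list_iff:
  assumes xs: "set xs \<subseteq> carrier PR"
  shows "p \<in> Idl\<^bsub>PR\<^esub> (set xs) \<longleftrightarrow>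
    (\<exists>c. (\<forall>i<length xs. c i \<in> carrier PR) \<and> p = (\<Sum>i<length xs. c i * xs ! i))"
proof
  let ?J = "{p. \<exists>c. (\<forall>i<length xs. c i \<in> carrier PR) \<and> p = (\<Sum>i<length xs. c i * xs ! i)}"
  have nth: "xs ! i \<in> carrier PR" if "i < length xs" for i using that xs nth_mem by blast
  have "ideal ?J PR"
  proof (rule ideal_polynomial_ringI)
    show "?J \<subseteq> carrier PR" using nth by (auto intro!: sum_in_PR mult_in_PR)
    show "0 \<in> ?J" using zero_in_PR by (intro CollectI exI[of _ "\<lambda>_. 0"]) simp
    fix p q assume "p \<in> ?J" "q \<in> ?J"
    then obtain c d where "\<forall>i<length xs. c i \<in> carrier PR" "p = (\<Sum>i<length xs. c i * xs ! i)"
        "\<forall>i<length xs. d i \<in> carrier PR" "q = (\<Sum>i<length xs. d i * xs ! i)" by blast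
    then show "p + q \<in> ?J"
      by (intro CollectI exI[of _ "\<lambda>i. c i + d i"]) (simp add: add_in_PR sum.distrib distrib_right)
  next
    fix p a assume "p \<in> ?J" and a: "a \<in> carrier PR"
    then obtain c where "\<forall>i<length xs. c i \<in> carrier PR" "p = (\<Sum>i<length xs. c i * xs ! i)" by blast
    then show "a * p \<in> ?J"
      using a by (intro CollectI exI[of _ "\<lambda>i. a * c i"]) (simp add: mult_in_PR sum_distrib_left mult.assoc)
  qed
  moreover have "set xs \<subseteq> ?J"
  proof
    fix x assume "x \<in> set xs"
    then obtain j where j: "j < length xs" "x = xs ! j" by (metis in_set_conv_nth)
    have "(\<Sum>i<length xs. (if i = j then 1 else 0) * xs ! i) = (\<Sum>i<length xs. if i = j then xs ! i else 0)"
      by (rule sum.cong) auto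
    also have "\<dots> = x" using j by simp
    finally show "x \<in> ?J"
      using zero_in_PR one_in_PR by (intro CollectI exI[of _ "\<lambda>i. if i = j then 1 else 0"]) auto
  qed
  ultimately have sub: "Idl\<^bsub>PR\<^esub> (set xs) \<subseteq> ?J" by (rule Idl_minimal)
  show "\<exists>c. (\<forall>i<length xs. c i \<in> carrier PR) \<and> p = (\<Sum>i<length xs. c i * xs ! i)"
    if "p \<in> Idl\<^bsub>PR\<^esub> (set xs)" using that sub by blast
  assume "\<exists>c. (\<forall>i<length xs. c i \<in> carrier PR) \<and> p = (\<Sum>i<length xs. c i * xs ! i)"
  then obtain c where c: "\<forall>i<length xs. c i \<in> carrier PR" "p = (\<Sum>i<length xs. c i * xs ! i)" by blast
  have "c i * xs ! i \<in> Idl\<^bsub>PR\<^esub> (set xs)" if "i < length xs" for i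
    using ideal_polynomial_ringD(4)[OF ideal_Idl[OF xs]] Idl_incl[OF xs] that c(1) nth_mem by blast
  then show "p \<in> Idl\<^bsub>PR\<^esub> (set xs)"
    unfolding c(2) by (intro ideal_polynomial_ringD(5)[OF ideal_Idl[OF xs]]) auto
qed

lemma polynomial_sum_monomials:
  "p = (\<Sum>k\<in>Poly_Mapping.keys p. Poly_Mapping.single k (Poly_Mapping.lookup p k))"
proof (rule poly_mapping_eqI)
  fix m
  have "Poly_Mapping.lookup (\<Sum>k\<in>Poly_Mapping.keys p. Poly_Mapping.single k (Poly_Mapping.lookup p k)) m
      = (\<Sum>k\<in>Poly_Mapping.keys p. if k = m then Poly_Mapping.lookup p k else 0)"
    by (simp add: lookup_sum lookup_single when_def)
  also have "\<dots> = Poly_Mapping.lookup p m"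
    by (simp add: in_keys_iff)
  finally show "Poly_Mapping.lookup p m
      = Poly_Mapping.lookup (\<Sum>k\<in>Poly_Mapping.keys p. Poly_Mapping.single k (Poly_Mapping.lookup p k)) m"
    by simp
qed

lemma lookup_mult_single:
  fixes m :: "'a::cancel_comm_monoid_add"
  shows "Poly_Mapping.lookup (p * Poly_Mapping.single m c) (k + m) = Poly_Mapping.lookup p k * c"
proof -
  have "p * Poly_Mapping.single m c
      = (\<Sum>j\<in>Poly_Mapping.keys p. Poly_Mapping.single (j + m) (Poly_Mapping.lookup p j * c))"
    by (subst polynomial_sum_monomials[of p]) (simp add: sum_distrib_right mult_single)
  then have "Poly_Mapping.lookup (p * Poly_Mapping.single m c) (k + m)
      = (\<Sum>j\<in>Poly_Mapping.keys p. if j = k then Poly_Mapping.lookup p j * c else 0)"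
    by (simp add: lookup_sum lookup_single when_def)
  also have "\<dots> = Poly_Mapping.lookup p k * c"
    by (simp add: in_keys_iff)
  finally show ?thesis .
qed

lemma lookup_mult_single_eq_0:
  fixes m :: "'a::cancel_comm_monoid_add"
  assumes "\<nexists>l. k = m + l"
  shows "Poly_Mapping.lookup (p * Poly_Mapping.single m c) k = 0"
proof (rule ccontr)
  assume "Poly_Mapping.lookup (p * Poly_Mapping.single m c) k \<noteq> 0"
  then have "k \<in> Poly_Mapping.keys (p * Poly_Mapping.single m c)" by (simp add: in_keys_iff)
  then obtain a b where "k = a + b" "b \<in> Poly_Mapping.keys (Poly_Mapping.single m c)"
    using keys_mult[of p "Poly_Mapping.single m c"] by blast
  moreover from this have "b = m" by (simp split: if_splits)
  ultimately show False using assms by (metis add.commute)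
qed

lemma keys_add_nat: "Poly_Mapping.keys (m + l :: 'a \<Rightarrow>\<^sub>0 nat) = Poly_Mapping.keys m \<union> Poly_Mapping.keys l"
  by (auto simp: in_keys_iff lookup_add)

lemma Idl_monomials:
  assumes M: "\<And>m. m \<in> M \<Longrightarrow> Poly_Mapping.keys m \<subseteq> V"
  shows "Idl\<^bsub>PR\<^esub> {Poly_Mapping.single m 1 | m. m \<in> M} =
    {p \<in> carrier PR. \<forall>k\<in>Poly_Mapping.keys p. \<exists>m\<in>M. \<exists>l. k = m + l}" (is "Idl\<^bsub>PR\<^esub> ?G = ?J")
proof
  have G: "?G \<subseteq> carrier PR" using M single_in_PR by blast
  have "ideal ?J PR"
  proof (rule ideal_polynomial_ringI)
    fix p q assume "p \<in> ?J" "q \<in> ?J"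
    then show "p + q \<in> ?J" using keys_add[of p q] add_in_PR[of p q] by blast
  next
    fix p c assume p: "p \<in> ?J" and c: "c \<in> carrier PR"
    have "\<exists>m\<in>M. \<exists>l. k = m + l" if k: "k \<in> Poly_Mapping.keys (c * p)" for k
    proof -
      obtain a b where ab: "k = a + b" "b \<in> Poly_Mapping.keys p" using keys_mult[of c p] k by blast
      then obtain m l where "m \<in> M" "b = m + l" using p by blast
      then have "k = m + (a + l)" using ab by (simp add: ac_simps)
      then show ?thesis using \<open>m \<in> M\<close> by blast
    qed
    then show "c * p \<in> ?J" using p mult_in_PR[OF c, of p] by blast
  qed (auto simp: zero_in_PR)
  moreover have "?G \<subseteq> ?J"
  proof
    fix g assume "g \<in> ?G"
    then obtain m where m: "m \<in> M" "g = Poly_Mapping.single m 1" by blast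
    have "m = m + 0" by simp
    then have "\<exists>m'\<in>M. \<exists>l. m = m' + l" using m(1) by blast
    then show "g \<in> ?J" using m(2) single_in_PR[OF M[OF m(1)]] by simp
  qed
  ultimately show "Idl\<^bsub>PR\<^esub> ?G \<subseteq> ?J" by (rule Idl_minimal)
  note J = ideal_polynomial_ringD[OF ideal_Idl[OF G]]
  show "?J \<subseteq> Idl\<^bsub>PR\<^esub> ?G"
  proof
    fix p assume p: "p \<in> ?J"
    have "Poly_Mapping.single k (Poly_Mapping.lookup p k) \<in> Idl\<^bsub>PR\<^esub> ?G" if k: "k \<in> Poly_Mapping.keys p" for k
    proof -
      obtain m l where m: "m \<in> M" "k = m + l" using p k by blast
      have "Poly_Mapping.keys l \<subseteq> Poly_Mapping.keys k" using m(2) by (simp add: keys_add_nat)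
      then have "Poly_Mapping.keys l \<subseteq> V" using p k unfolding mem_polynomial_ring by blast
      moreover have "Poly_Mapping.single m 1 \<in> Idl\<^bsub>PR\<^esub> ?G" using Idl_incl[OF G] m by blast
      ultimately have "Poly_Mapping.single l (Poly_Mapping.lookup p k) * Poly_Mapping.single m 1 \<in> Idl\<^bsub>PR\<^esub> ?G"
        by (intro J(4) single_in_PR)
      then show ?thesis by (simp add: mult_single m(2) add.commute)
    qed
    then have "(\<Sum>k\<in>Poly_Mapping.keys p. Poly_Mapping.single k (Poly_Mapping.lookup p k)) \<in> Idl\<^bsub>PR\<^esub> ?G"
      by (rule J(5))
    then show "p \<in> Idl\<^bsub>PR\<^esub> ?G" using polynomial_sum_monomials[of p] by simp
  qed
qed

text \<open>The coefficients of a relation between the elements of a regular sequence lie in the ideal that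
  it generates. The statement about initial segments is the one that allows induction.\<close>

lemma regular_seq_syzygy:
  assumes reg: "regular_seq PR xs" and n: "n \<le> length xs"
    and a: "\<And>i. i < n \<Longrightarrow> a i \<in> carrier PR" and syz: "(\<Sum>i<n. a i * xs ! i) = 0" and "i < n"
  shows "a i \<in> Idl\<^bsub>PR\<^esub> (set (take n xs))"
  using n a syz \<open>i < n\<close>
proof (induction n arbitrary: a i)
  case 0
  then show ?case by simp
next
  case (Suc n)
  have xs: "set xs \<subseteq> carrier PR" using reg unfolding regular_seq_def by blast
  have tk: "set (take k xs) \<subseteq> carrier PR" for k using xs set_take_subset[of k xs] by blast
  have nth: "xs ! i \<in> carrier PR" if "i < length xs" for i using that xs nth_mem by blast
  have take_nth: "take n xs ! i = xs ! i" if "i < n" for i using that by simp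
  have len: "length (take n xs) = n" using Suc.prems(1) by simp
  have tkSuc: "set (take n xs) \<subseteq> set (take (Suc n) xs)" by (rule set_take_subset_set_take) simp
  have mono: "Idl\<^bsub>PR\<^esub> (set (take n xs)) \<subseteq> Idl\<^bsub>PR\<^esub> (set (take (Suc n) xs))"
    using Idl_minimal[OF ideal_Idl[OF tk[of "Suc n"]], of "set (take n xs)"] Idl_incl[OF tk[of "Suc n"]] tkSuc by blast
  have eq: "a n * xs ! n = (\<Sum>i<n. (- a i) * xs ! i)"
    using Suc.prems(3) by (simp add: sum_negf eq_neg_iff_add_eq_0 add.commute)
  have "a n * xs ! n \<in> Idl\<^bsub>PR\<^esub> (set (take n xs))"
    unfolding mem_Idl_list_iff[OF tk] len eq
    using Suc.prems(2) uminus_in_PR by (intro exI[of _ "\<lambda>i. - a i"]) (simp add: take_nth)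
  then have an: "a n \<in> Idl\<^bsub>PR\<^esub> (set (take n xs))"
    using reg Suc.prems(1,2) unfolding regular_seq_def by simp
  then obtain b where b: "\<And>i. i < n \<Longrightarrow> b i \<in> carrier PR" "a n = (\<Sum>i<n. b i * xs ! i)"
    unfolding mem_Idl_list_iff[OF tk] len by (auto simp: take_nth)
  show ?case
  proof (cases "i = n")
    case True
    then show ?thesis using an mono by blast
  next
    case False
    then have i: "i < n" using Suc.prems(4) by simp
    have "(\<Sum>i<n. (a i + b i * xs ! n) * xs ! i) = (\<Sum>i<n. a i * xs ! i) + (\<Sum>i<n. b i * xs ! i) * xs ! n"
      by (simp add: sum.distrib distrib_right sum_distrib_right mult.assoc mult.commute[of "xs ! n"])
    also have "\<dots> = 0" using Suc.prems(3) b(2) by simp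
    finally have "a i + b i * xs ! n \<in> Idl\<^bsub>PR\<^esub> (set (take n xs))"
      using Suc.IH[of "\<lambda>i. a i + b i * xs ! n" i] i Suc.prems(1,2) b(1) nth[of n]
      by (simp add: add_in_PR mult_in_PR)
    then have 1: "a i + b i * xs ! n \<in> Idl\<^bsub>PR\<^esub> (set (take (Suc n) xs))" using mono by blast
    have "xs ! n \<in> set (take (Suc n) xs)"
      using Suc.prems(1) by (simp add: take_Suc_conv_app_nth)
    then have "xs ! n \<in> Idl\<^bsub>PR\<^esub> (set (take (Suc n) xs))" using Idl_incl[OF tk] by blast
    then have "(- b i) * xs ! n \<in> Idl\<^bsub>PR\<^esub> (set (take (Suc n) xs))"
      using ideal_polynomial_ringD(4)[OF ideal_Idl[OF tk]] uminus_in_PR[OF b(1)[OF i]] by blast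
    with 1 have "(a i + b i * xs ! n) + (- b i) * xs ! n \<in> Idl\<^bsub>PR\<^esub> (set (take (Suc n) xs))"
      by (rule ideal_polynomial_ringD(3)[OF ideal_Idl[OF tk]])
    then show ?thesis by simp
  qed
qed

end

section \<open>Stanley--Reisner ideals generated by regular sequences\<close>

text \<open>The exponent vector of the squarefree monomial with support \<open>F\<close>.\<close>

definition indicator_monomial :: "'v set \<Rightarrow> ('v \<Rightarrow>\<^sub>0 nat)" where
  "indicator_monomial F = (\<Sum>v\<in>F. Poly_Mapping.single v 1)"

lemma squarefree_monomial_eq: "squarefree_monomial F = Poly_Mapping.single (indicator_monomial F) 1"
  unfolding squarefree_monomial_def indicator_monomial_def ..

lemma lookup_indicator_monomial:
  "finite F \<Longrightarrow> Poly_Mapping.lookup (indicator_monomial F) v = (if v \<in> F then 1 else 0)"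
  unfolding indicator_monomial_def by (simp add: lookup_sum lookup_single when_def)

lemma keys_indicator_monomial: "finite F \<Longrightarrow> Poly_Mapping.keys (indicator_monomial F) = F"
  unfolding set_eq_iff in_keys_iff by (simp add: lookup_indicator_monomial)

lemma indicator_monomial_dvd_iff:
  assumes "finite F"
  shows "(\<exists>l. k = indicator_monomial F + l) \<longleftrightarrow> F \<subseteq> Poly_Mapping.keys k"
proof
  assume "\<exists>l. k = indicator_monomial F + l"
  then obtain l where "k = indicator_monomial F + l" ..
  then show "F \<subseteq> Poly_Mapping.keys k"
    by (simp add: keys_add_nat keys_indicator_monomial[OF assms])
next
  assume F: "F \<subseteq> Poly_Mapping.keys k"
  have "k = indicator_monomial F + (k - indicator_monomial F)"
  proof (rule poly_mapping_eqI)
    fix v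
    show "Poly_Mapping.lookup k v = Poly_Mapping.lookup (indicator_monomial F + (k - indicator_monomial F)) v"
      using F by (auto simp: lookup_add lookup_minus lookup_indicator_monomial[OF assms] in_keys_iff)
  qed
  then show "\<exists>l. k = indicator_monomial F + l" by blast
qed

lemma indicator_monomial_Un:
  "finite F \<Longrightarrow> finite G \<Longrightarrow> F \<inter> G = {} \<Longrightarrow>
    indicator_monomial (F \<union> G) = indicator_monomial F + indicator_monomial G"
  unfolding indicator_monomial_def by (rule sum.union_disjoint)

context
  fixes K :: "'k::field itself" and \<Delta> :: "'v set set"
  assumes cpx: "finite_complex \<Delta>"
begin

abbreviation (input) "S \<equiv> polynomial_ring K (\<Union>\<Delta>)"

lemma finite_vertices: "finite (\<Union>\<Delta>)"
  using cpx unfolding finite_complex_def by blast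

text \<open>Any family of nonfaces containing the minimal ones generates the ideal of all polynomials
  whose monomials are supported on nonfaces.\<close>

lemma Idl_nonfaces:
  assumes NF: "\<And>F. F \<in> NF \<Longrightarrow> F \<subseteq> \<Union>\<Delta> \<and> F \<notin> \<Delta>"
    and min: "\<And>N. minimal_nonface \<Delta> N \<Longrightarrow> N \<in> NF"
  shows "Idl\<^bsub>S\<^esub> (squarefree_monomial ` NF) =
    {p \<in> carrier S. \<forall>k\<in>Poly_Mapping.keys p. Poly_Mapping.keys k \<notin> \<Delta>}"
proof -
  have fin: "finite F" if "F \<in> NF" for F using NF[OF that] finite_vertices finite_subset by blast
  have eq: "squarefree_monomial ` NF = {Poly_Mapping.single m 1 | m. m \<in> indicator_monomial ` NF}"
    by (auto simp: squarefree_monomial_eq)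
  have kV: "Poly_Mapping.keys m \<subseteq> \<Union>\<Delta>" if m: "m \<in> indicator_monomial ` NF" for m
  proof -
    obtain F where F: "F \<in> NF" "m = indicator_monomial F" using m by blast
    show ?thesis using NF[OF F(1)] unfolding F(2) keys_indicator_monomial[OF fin[OF F(1)]] by blast
  qed
  have "(\<exists>m\<in>indicator_monomial ` NF. \<exists>l. k = m + l) \<longleftrightarrow> Poly_Mapping.keys k \<notin> \<Delta>"
    if "Poly_Mapping.keys k \<subseteq> \<Union>\<Delta>" for k
  proof -
    have "(\<exists>m\<in>indicator_monomial ` NF. \<exists>l. k = m + l) \<longleftrightarrow> (\<exists>F\<in>NF. F \<subseteq> Poly_Mapping.keys k)"
      using indicator_monomial_dvd_iff[OF fin] by auto
    also have "\<dots> \<longleftrightarrow> Poly_Mapping.keys k \<notin> \<Delta>"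
    proof
      assume "\<exists>F\<in>NF. F \<subseteq> Poly_Mapping.keys k"
      then show "Poly_Mapping.keys k \<notin> \<Delta>" using NF face_subset[OF cpx] by blast
    next
      assume "Poly_Mapping.keys k \<notin> \<Delta>"
      then show "\<exists>F\<in>NF. F \<subseteq> Poly_Mapping.keys k"
        using minimal_nonface_exists[OF cpx that] min by blast
    qed
    finally show ?thesis .
  qed
  then have "(\<forall>k\<in>Poly_Mapping.keys p. \<exists>m\<in>indicator_monomial ` NF. \<exists>l. k = m + l)
      \<longleftrightarrow> (\<forall>k\<in>Poly_Mapping.keys p. Poly_Mapping.keys k \<notin> \<Delta>)" if "p \<in> carrier S" for p
    using that unfolding mem_polynomial_ring by blast
  moreover have "Idl\<^bsub>S\<^esub> (squarefree_monomial ` NF) =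
      {p \<in> carrier S. \<forall>k\<in>Poly_Mapping.keys p. \<exists>m\<in>indicator_monomial ` NF. \<exists>l. k = m + l}"
    unfolding eq by (rule Idl_monomials) (rule kV)
  ultimately show ?thesis by auto
qed

lemma stanley_reisner_ideal_eq:
  "stanley_reisner_ideal K (\<Union>\<Delta>) \<Delta> =
    {p \<in> carrier S. \<forall>k\<in>Poly_Mapping.keys p. Poly_Mapping.keys k \<notin> \<Delta>}"
proof -
  have "{squarefree_monomial F :: ('v \<Rightarrow>\<^sub>0 nat) \<Rightarrow>\<^sub>0 'k | F. F \<subseteq> \<Union>\<Delta> \<and> F \<notin> \<Delta>}
      = squarefree_monomial ` {F. F \<subseteq> \<Union>\<Delta> \<and> F \<notin> \<Delta>}"
    by (auto simp: image_def)
  then show ?thesis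
    unfolding stanley_reisner_ideal_def
    using Idl_nonfaces[of "{F. F \<subseteq> \<Union>\<Delta> \<and> F \<notin> \<Delta>}"] by (simp add: minimal_nonface_def)
qed

lemma finite_minimal_nonfaces: "finite {N. minimal_nonface \<Delta> N}"
proof (rule finite_subset)
  show "{N. minimal_nonface \<Delta> N} \<subseteq> Pow (\<Union>\<Delta>)" unfolding minimal_nonface_def by blast
  show "finite (Pow (\<Union>\<Delta>))" using finite_vertices by simp
qed

lemma stanley_reisner_ideal_minimal:
  "stanley_reisner_ideal K (\<Union>\<Delta>) \<Delta> = Idl\<^bsub>S\<^esub> (squarefree_monomial ` {N. minimal_nonface \<Delta> N})"
  unfolding stanley_reisner_ideal_eq
  by (rule Idl_nonfaces[symmetric]) (auto simp: minimal_nonface_def)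

lemma generated_by_regular_seq_if_disjoint_nonfaces:
  assumes disj: "disjoint_nonfaces \<Delta>"
  shows "generated_by_regular_seq S (stanley_reisner_ideal K (\<Union>\<Delta>) \<Delta>)"
proof -
  obtain Ns where Ns: "set Ns = {N. minimal_nonface \<Delta> N}" "distinct Ns"
    using finite_distinct_list[OF finite_minimal_nonfaces] by blast
  let ?xs = "map squarefree_monomial Ns :: (('v \<Rightarrow>\<^sub>0 nat) \<Rightarrow>\<^sub>0 'k) list"
  have N: "N \<subseteq> \<Union>\<Delta>" "finite N" if "N \<in> set Ns" for N
  proof -
    show "N \<subseteq> \<Union>\<Delta>" using that Ns(1) unfolding minimal_nonface_def by blast
    then show "finite N" using finite_vertices by (rule finite_subset)
  qed
  have I: "stanley_reisner_ideal K (\<Union>\<Delta>) \<Delta> = Idl\<^bsub>S\<^esub> (set ?xs)"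
    unfolding stanley_reisner_ideal_minimal using Ns(1) by simp
  have Idl_take: "Idl\<^bsub>S\<^esub> (set (take i ?xs)) =
      {p \<in> carrier S. \<forall>k\<in>Poly_Mapping.keys p. \<exists>N\<in>set (take i Ns). N \<subseteq> Poly_Mapping.keys k}" for i
  proof -
    have sub: "set (take i Ns) \<subseteq> set Ns" by (rule set_take_subset)
    have eq: "set (take i ?xs) = {Poly_Mapping.single m 1 | m. m \<in> indicator_monomial ` set (take i Ns)}"
      by (auto simp: take_map squarefree_monomial_eq)
    have kV: "Poly_Mapping.keys m \<subseteq> \<Union>\<Delta>" if m: "m \<in> indicator_monomial ` set (take i Ns)" for m
    proof -
      obtain M where M: "M \<in> set (take i Ns)" "m = indicator_monomial M" using m by blast
      then have "M \<in> set Ns" using sub by blast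
      then show ?thesis using N M by (simp add: keys_indicator_monomial)
    qed
    have "(\<exists>m\<in>indicator_monomial ` set (take i Ns). \<exists>l. k = m + l)
        \<longleftrightarrow> (\<exists>N\<in>set (take i Ns). N \<subseteq> Poly_Mapping.keys k)" for k
      using indicator_monomial_dvd_iff[OF N(2)] sub by (simp add: subset_iff)
    moreover have "Idl\<^bsub>S\<^esub> (set (take i ?xs)) = {p \<in> carrier S. \<forall>k\<in>Poly_Mapping.keys p.
        \<exists>m\<in>indicator_monomial ` set (take i Ns). \<exists>l. k = m + l}"
      unfolding eq by (rule Idl_monomials) (rule kV)
    ultimately show ?thesis by simp
  qed
  have "regular_seq S ?xs"
    unfolding regular_seq_def
  proof (intro conjI allI impI ballI)
    show "set ?xs \<subseteq> carrier S"
    proof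
      fix x assume "x \<in> set ?xs"
      then obtain M where M: "M \<in> set Ns" "x = squarefree_monomial M" by auto
      then show "x \<in> carrier S"
        unfolding M(2) squarefree_monomial_eq
        using N[OF M(1)] by (intro single_in_PR) (simp add: keys_indicator_monomial)
    qed
    have "1 \<notin> Idl\<^bsub>S\<^esub> (set ?xs)"
      using cpx unfolding I[symmetric] stanley_reisner_ideal_eq finite_complex_def by simp
    then show "Idl\<^bsub>S\<^esub> (set ?xs) \<noteq> carrier S" using one_in_PR by blast
    fix i a assume i: "i < length ?xs" and a: "a \<in> carrier S"
      and ai: "a \<otimes>\<^bsub>S\<^esub> ?xs ! i \<in> Idl\<^bsub>S\<^esub> (set (take i ?xs))"
    have Ni: "Ns ! i \<in> set Ns" using i by simp
    have "\<exists>N\<in>set (take i Ns). N \<subseteq> Poly_Mapping.keys k" if k: "k \<in> Poly_Mapping.keys a" for k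
    proof -
      let ?m = "indicator_monomial (Ns ! i)"
      \<comment> \<open>An earlier generator that divides the product of \<open>X\<^sup>k\<close> with the \<open>i\<close>-th generator
        is coprime to the latter, so it divides \<open>X\<^sup>k\<close>.\<close>
      have "Poly_Mapping.lookup (a * Poly_Mapping.single ?m 1) (k + ?m) = Poly_Mapping.lookup a k"
        by (simp add: lookup_mult_single)
      then have "k + ?m \<in> Poly_Mapping.keys (a \<otimes>\<^bsub>S\<^esub> ?xs ! i)"
        using k i by (simp add: in_keys_iff squarefree_monomial_eq)
      then obtain M where M: "M \<in> set (take i Ns)" "M \<subseteq> Poly_Mapping.keys (k + ?m)"
        using ai unfolding Idl_take by blast
      have "M \<in> set Ns" using M(1) by (rule in_set_takeD)
      have "M \<noteq> Ns ! i"
      proof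
        assume "M = Ns ! i"
        then obtain j where "j < i" "Ns ! j = Ns ! i" using M(1) i by (auto simp: in_set_conv_nth)
        then show False using Ns(2) i by (simp add: nth_eq_iff_index_eq)
      qed
      then have "M \<inter> Ns ! i = {}" using disj \<open>M \<in> set Ns\<close> Ni Ns(1) unfolding disjoint_nonfaces_def by blast
      moreover have "M \<subseteq> Poly_Mapping.keys k \<union> Ns ! i"
        using M(2) N(2)[OF Ni] by (simp add: keys_add_nat keys_indicator_monomial)
      ultimately show ?thesis using M(1) by blast
    qed
    then show "a \<in> Idl\<^bsub>S\<^esub> (set (take i ?xs))" unfolding Idl_take using a by blast
  qed
  then show ?thesis using I unfolding generated_by_regular_seq_def by blast
qed

text \<open>The regular sequence is arbitrary: its elements need not be monomials, nor homogeneous, and its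
  length is not assumed to be the number of minimal nonfaces.\<close>

lemma disjoint_nonfaces_if_generated_by_regular_seq:
  assumes gen: "generated_by_regular_seq S (stanley_reisner_ideal K (\<Union>\<Delta>) \<Delta>)"
  shows "disjoint_nonfaces \<Delta>"
  unfolding disjoint_nonfaces_def
proof (intro allI impI)
  fix M N assume M: "minimal_nonface \<Delta> M" and N: "minimal_nonface \<Delta> N" and ne: "M \<noteq> N"
  let ?I = "stanley_reisner_ideal K (\<Union>\<Delta>) \<Delta>"
  let ?mon = "squarefree_monomial :: 'v set \<Rightarrow> ('v \<Rightarrow>\<^sub>0 nat) \<Rightarrow>\<^sub>0 'k"
  have nf: "L \<subseteq> \<Union>\<Delta>" "finite L" "L \<notin> \<Delta>" if "minimal_nonface \<Delta> L" for L
  proof -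
    show "L \<subseteq> \<Union>\<Delta>" "L \<notin> \<Delta>" using that unfolding minimal_nonface_def by blast+
    then show "finite L" using finite_vertices by (meson finite_subset)
  qed
  have nsub: "\<not> L \<subseteq> L'" if "minimal_nonface \<Delta> L" "minimal_nonface \<Delta> L'" "L \<noteq> L'" for L L'
    using that unfolding minimal_nonface_def by blast
  obtain xs where xs: "regular_seq S xs" "?I = Idl\<^bsub>S\<^esub> (set xs)"
    using gen unfolding generated_by_regular_seq_def by blast
  have xsS: "set xs \<subseteq> carrier S" using xs(1) unfolding regular_seq_def by blast
  obtain Ns where Ns: "set Ns = {N. minimal_nonface \<Delta> N}" "distinct Ns"
    using finite_distinct_list[OF finite_minimal_nonfaces] by blast
  obtain k where k: "k < length Ns" "Ns ! k = M" using M Ns(1) by (metis in_set_conv_nth mem_Collect_eq)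
  have monI: "?mon L \<in> ?I" if "minimal_nonface \<Delta> L" for L
    unfolding stanley_reisner_ideal_eq squarefree_monomial_eq
    using nf[OF that] by (simp add: single_in_PR keys_indicator_monomial)
  have "?I = Idl\<^bsub>S\<^esub> (set (map ?mon Ns))"
    unfolding stanley_reisner_ideal_minimal using Ns(1) by simp
  moreover have monS: "set (map ?mon Ns) \<subseteq> carrier S"
  proof
    fix x assume "x \<in> set (map ?mon Ns)"
    then obtain L where "minimal_nonface \<Delta> L" "x = ?mon L" using Ns(1) by auto
    then show "x \<in> carrier S" using monI unfolding stanley_reisner_ideal_eq by blast
  qed
  ultimately have I_mon: "p \<in> ?I \<longleftrightarrow> (\<exists>c. (\<forall>j<length Ns. c j \<in> carrier S)
      \<and> p = (\<Sum>j<length Ns. c j * ?mon (Ns ! j)))" for p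
    using mem_Idl_list_iff[OF monS] by simp
  \<comment> \<open>Express the regular sequence through the minimal monomial generators, and \<open>M\<close> and \<open>N\<close>
    through the regular sequence.\<close>
  have "\<forall>i. \<exists>c. i < length xs \<longrightarrow> (\<forall>j<length Ns. c j \<in> carrier S)
      \<and> xs ! i = (\<Sum>j<length Ns. c j * ?mon (Ns ! j))"
  proof
    fix i
    have "xs ! i \<in> ?I" if "i < length xs" using that xs(2) Idl_incl[OF xsS] nth_mem by blast
    then show "\<exists>c. i < length xs \<longrightarrow> (\<forall>j<length Ns. c j \<in> carrier S)
      \<and> xs ! i = (\<Sum>j<length Ns. c j * ?mon (Ns ! j))" unfolding I_mon by blast
  qed
  from choice[OF this] obtain A where A: "\<And>i j. i < length xs \<Longrightarrow> j < length Ns \<Longrightarrow> A i j \<in> carrier S"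
      "\<And>i. i < length xs \<Longrightarrow> xs ! i = (\<Sum>j<length Ns. A i j * ?mon (Ns ! j))"
    by blast
  have I_xs: "p \<in> ?I \<longleftrightarrow> (\<exists>c. (\<forall>i<length xs. c i \<in> carrier S) \<and> p = (\<Sum>i<length xs. c i * xs ! i))" for p
    unfolding xs(2) by (rule mem_Idl_list_iff[OF xsS])
  obtain B where B: "\<And>i. i < length xs \<Longrightarrow> B i \<in> carrier S" "?mon M = (\<Sum>i<length xs. B i * xs ! i)"
    using monI[OF M] unfolding I_xs by blast
  obtain C where C: "\<And>i. i < length xs \<Longrightarrow> C i \<in> carrier S" "?mon N = (\<Sum>i<length xs. C i * xs ! i)"
    using monI[OF N] unfolding I_xs by blast
  have finMN: "finite (M - N)" "finite (N - M)" using nf[OF M] nf[OF N] by blast+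
  have uS: "?mon (N - M) \<in> carrier S" "?mon (M - N) \<in> carrier S"
    unfolding squarefree_monomial_eq
    using nf[OF M] nf[OF N] finMN by (auto simp: keys_indicator_monomial intro!: single_in_PR)
  have ind: "indicator_monomial (N - M) + indicator_monomial M = indicator_monomial (M - N) + indicator_monomial N"
  proof -
    have "(N - M) \<union> M = (M - N) \<union> N" "(N - M) \<inter> M = {}" "(M - N) \<inter> N = {}" by blast+
    then show ?thesis
      using indicator_monomial_Un[OF finMN(2) nf(2)[OF M]] indicator_monomial_Un[OF finMN(1) nf(2)[OF N]]
      by simp
  qed
  have ind': "?mon (N - M) * ?mon M = ?mon (M - N) * ?mon N"
    unfolding squarefree_monomial_eq by (simp add: mult_single ind)
  \<comment> \<open>The syzygy between the two monomials has its coefficients in the ideal once it is written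
    in terms of the regular sequence.\<close>
  define e where "e i = ?mon (N - M) * B i - ?mon (M - N) * C i" for i
  have eS: "e i \<in> carrier S" if "i < length xs" for i
    unfolding e_def diff_conv_add_uminus
    using that by (intro add_in_PR uminus_in_PR mult_in_PR uS B C)
  have "(\<Sum>i<length xs. e i * xs ! i) = ?mon (N - M) * ?mon M - ?mon (M - N) * ?mon N"
    unfolding B(2) C(2) e_def by (simp add: sum_distrib_left left_diff_distrib sum_subtractf mult.assoc)
  also have "\<dots> = 0" using ind' by simp
  finally have "e i \<in> ?I" if "i < length xs" for i
    using regular_seq_syzygy[OF xs(1) order.refl, of e i] eS that xs(2) by simp
  then have "A i k * e i \<in> ?I" if "i < length xs" for i
    using that ideal_polynomial_ringD(4)[OF ideal_Idl[OF xsS]] A(1)[OF that k(1)] xs(2) by blast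
  then have "(\<Sum>i<length xs. A i k * e i) \<in> ?I"
    unfolding xs(2) by (intro ideal_polynomial_ringD(5)[OF ideal_Idl[OF xsS]]) auto
  moreover define D where "D j = (\<Sum>i<length xs. B i * A i j)" for j
  moreover define E where "E = (\<Sum>i<length xs. C i * A i k)"
  ultimately have DE: "?mon (N - M) * D k - ?mon (M - N) * E \<in> ?I"
    by (simp add: e_def sum_distrib_left sum_subtractf right_diff_distrib ac_simps)
  \<comment> \<open>Minimality of \<open>M\<close> among the monomial generators forces the constant term of \<open>D k\<close> to be 1.\<close>
  have "?mon M = (\<Sum>i<length xs. \<Sum>j<length Ns. B i * A i j * ?mon (Ns ! j))"
    unfolding B(2) using A(2) by (simp add: sum_distrib_left mult.assoc)
  also have "\<dots> = (\<Sum>j<length Ns. D j * ?mon (Ns ! j))"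
    unfolding D_def by (subst sum.swap) (simp add: sum_distrib_right)
  finally have "Poly_Mapping.lookup (?mon M) (indicator_monomial M)
      = (\<Sum>j<length Ns. Poly_Mapping.lookup (D j * ?mon (Ns ! j)) (indicator_monomial M))"
    by (simp add: lookup_sum)
  also have "\<dots> = (\<Sum>j<length Ns. if j = k then Poly_Mapping.lookup (D j) 0 else 0)"
  proof (rule sum.cong)
    fix j assume j: "j \<in> {..<length Ns}"
    show "Poly_Mapping.lookup (D j * ?mon (Ns ! j)) (indicator_monomial M)
        = (if j = k then Poly_Mapping.lookup (D j) 0 else 0)"
    proof (cases "j = k")
      case True
      then show ?thesis
        using lookup_mult_single[of "D k" "indicator_monomial M" 1 0] k(2) by (simp add: squarefree_monomial_eq)
    next
      case False
      have Nj: "minimal_nonface \<Delta> (Ns ! j)" using j Ns(1) nth_mem by blast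
      have "Ns ! j \<noteq> M" using False k j Ns(2) by (metis lessThan_iff nth_eq_iff_index_eq)
      then have "\<not> Ns ! j \<subseteq> Poly_Mapping.keys (indicator_monomial M)"
        using nsub[OF Nj M] nf[OF M] by (simp add: keys_indicator_monomial)
      then have "Poly_Mapping.lookup (D j * ?mon (Ns ! j)) (indicator_monomial M) = 0"
        unfolding squarefree_monomial_eq
        by (intro lookup_mult_single_eq_0) (simp add: indicator_monomial_dvd_iff[OF nf(2)[OF Nj]])
      then show ?thesis using False by simp
    qed
  qed simp
  also have "\<dots> = Poly_Mapping.lookup (D k) 0" using k(1) by simp
  finally have D1: "Poly_Mapping.lookup (D k) 0 = 1" by (simp add: squarefree_monomial_eq)
  \<comment> \<open>So the monomial of \<open>N - M\<close> has coefficient 1 in an element of the ideal: it is not divisible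
    by the monomial of the nonempty set \<open>M - N\<close>.\<close>
  have "\<not> M - N \<subseteq> Poly_Mapping.keys (indicator_monomial (N - M))"
    using nsub[OF M N ne] finMN by (auto simp: keys_indicator_monomial)
  then have "Poly_Mapping.lookup (?mon (M - N) * E) (indicator_monomial (N - M)) = 0"
    unfolding squarefree_monomial_eq mult.commute[of _ E]
    by (intro lookup_mult_single_eq_0) (simp add: indicator_monomial_dvd_iff[OF finMN(1)])
  moreover have "Poly_Mapping.lookup (?mon (N - M) * D k) (indicator_monomial (N - M)) = 1"
    using lookup_mult_single[of "D k" "indicator_monomial (N - M)" 1 0] D1
    by (simp add: squarefree_monomial_eq mult.commute)
  ultimately have "indicator_monomial (N - M) \<in> Poly_Mapping.keys (?mon (N - M) * D k - ?mon (M - N) * E)"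
    by (simp add: in_keys_iff lookup_minus)
  then have "N - M \<notin> \<Delta>"
    using DE finMN unfolding stanley_reisner_ideal_eq by (auto simp: keys_indicator_monomial)
  then show "M \<inter> N = {}" using N unfolding minimal_nonface_def by blast
qed

theorem generated_by_regular_seq_iff_disjoint_nonfaces:
  "generated_by_regular_seq S (stanley_reisner_ideal K (\<Union>\<Delta>) \<Delta>) \<longleftrightarrow> disjoint_nonfaces \<Delta>"
  using generated_by_regular_seq_if_disjoint_nonfaces disjoint_nonfaces_if_generated_by_regular_seq by blast

end

section \<open>Localization at a prime ideal\<close>

context primeideal
begin

text \<open>For the prime ideal \<open>I\<close>, \<open>D\<close> is the set of denominators, \<open>L\<close> the localization and
  \<open>fr r s\<close> the fraction \<open>r / s\<close>.\<close>

abbreviation "D \<equiv> carrier R - I"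
abbreviation "L \<equiv> localization R I"
abbreviation "fr \<equiv> fraction R I"

lemma one_D: "\<one> \<in> D"
  using one_imp_carrier I_notcarr by blast

lemma mult_D: "s \<in> D \<Longrightarrow> t \<in> D \<Longrightarrow> s \<otimes> t \<in> D"
  using I_prime by blast

lemma mem_frac: "(r', s') \<in> fr r s \<longleftrightarrow>
    r' \<in> carrier R \<and> s' \<in> D \<and> (\<exists>u\<in>D. u \<otimes> (s' \<otimes> r) = u \<otimes> (s \<otimes> r'))"
  unfolding fraction_def by simp

lemma frac_self: "r \<in> carrier R \<Longrightarrow> s \<in> D \<Longrightarrow> (r, s) \<in> fr r s"
  unfolding mem_frac using one_D by blast

lemma frac_trans:
  assumes "r \<in> carrier R" "s \<in> D" "r' \<in> carrier R" "s' \<in> D"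
    and u: "u \<in> D" "u \<otimes> (s' \<otimes> r) = u \<otimes> (s \<otimes> r')"
    and ab: "(a, b) \<in> fr r s"
  shows "(a, b) \<in> fr r' s'"
proof -
  obtain v where a: "a \<in> carrier R" "b \<in> D" and v: "v \<in> D" "v \<otimes> (b \<otimes> r) = v \<otimes> (s \<otimes> a)"
    using ab unfolding mem_frac by blast
  have carr: "s \<in> carrier R" "s' \<in> carrier R" "b \<in> carrier R" "u \<in> carrier R" "v \<in> carrier R"
    using assms a v by blast+
  have "(u \<otimes> v \<otimes> s) \<otimes> (b \<otimes> r') = v \<otimes> b \<otimes> (u \<otimes> (s \<otimes> r'))"
    using carr assms(1,3) a(1) by (simp add: m_ac)
  also have "\<dots> = v \<otimes> b \<otimes> (u \<otimes> (s' \<otimes> r))" using u by simp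
  also have "\<dots> = u \<otimes> s' \<otimes> (v \<otimes> (b \<otimes> r))"
    using carr assms(1,3) a(1) by (simp add: m_ac)
  also have "\<dots> = u \<otimes> s' \<otimes> (v \<otimes> (s \<otimes> a))" using v by simp
  also have "\<dots> = (u \<otimes> v \<otimes> s) \<otimes> (s' \<otimes> a)"
    using carr assms(1,3) a(1) by (simp add: m_ac)
  finally have "(u \<otimes> v \<otimes> s) \<otimes> (b \<otimes> r') = (u \<otimes> v \<otimes> s) \<otimes> (s' \<otimes> a)" .
  moreover have "u \<otimes> v \<otimes> s \<in> D" using u v assms mult_D by blast
  ultimately show ?thesis unfolding mem_frac using a by blast
qed

lemma frac_eq_iff:
  assumes "r \<in> carrier R" "s \<in> D" "r' \<in> carrier R" "s' \<in> D"
  shows "fr r s = fr r' s' \<longleftrightarrow> (\<exists>u\<in>D. u \<otimes> (s' \<otimes> r) = u \<otimes> (s \<otimes> r'))"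
proof
  assume "fr r s = fr r' s'"
  then have "(r', s') \<in> fr r s" using frac_self assms by simp
  then show "\<exists>u\<in>D. u \<otimes> (s' \<otimes> r) = u \<otimes> (s \<otimes> r')" unfolding mem_frac by blast
next
  assume "\<exists>u\<in>D. u \<otimes> (s' \<otimes> r) = u \<otimes> (s \<otimes> r')"
  then obtain u where u: "u \<in> D" "u \<otimes> (s' \<otimes> r) = u \<otimes> (s \<otimes> r')" by blast
  show "fr r s = fr r' s'"
    using frac_trans[OF assms u] frac_trans[OF assms(3,4,1,2) u(1) u(2)[symmetric]] by auto
qed

lemma frac_eqI:
  assumes "r \<in> carrier R" "s \<in> D" "r' \<in> carrier R" "s' \<in> D" "s' \<otimes> r = s \<otimes> r'"
  shows "fr r s = fr r' s'"
  using assms one_D by (subst frac_eq_iff) auto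

lemma frac_cancel:
  assumes "r \<in> carrier R" "s \<in> D" "t \<in> D"
  shows "fr (t \<otimes> r) (t \<otimes> s) = fr r s"
  using assms mult_D by (intro frac_eqI) (auto simp: m_ac)

lemma frac_mult:
  assumes "r \<in> carrier R" "s \<in> D" "r' \<in> carrier R" "s' \<in> D"
  shows "fr r s \<otimes>\<^bsub>L\<^esub> fr r' s' = fr (r \<otimes> r') (s \<otimes> s')"
proof -
  have *: "fr (a \<otimes> a') (b \<otimes> b') = fr (r \<otimes> r') (s \<otimes> s')"
    if ab: "(a, b) \<in> fr r s" and ab': "(a', b') \<in> fr r' s'" for a b a' b'
  proof -
    obtain u where a: "a \<in> carrier R" "b \<in> D" and u: "u \<in> D" "u \<otimes> (b \<otimes> r) = u \<otimes> (s \<otimes> a)"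
      using ab unfolding mem_frac by blast
    obtain v where a': "a' \<in> carrier R" "b' \<in> D" and v: "v \<in> D" "v \<otimes> (b' \<otimes> r') = v \<otimes> (s' \<otimes> a')"
      using ab' unfolding mem_frac by blast
    have carr: "s \<in> carrier R" "s' \<in> carrier R" "b \<in> carrier R" "b' \<in> carrier R" "u \<in> carrier R" "v \<in> carrier R"
      using assms a a' u v by blast+
    have "(u \<otimes> v) \<otimes> ((b \<otimes> b') \<otimes> (r \<otimes> r')) = (u \<otimes> (b \<otimes> r)) \<otimes> (v \<otimes> (b' \<otimes> r'))"
      using carr assms(1,3) by (simp add: m_ac)
    also have "\<dots> = (u \<otimes> (s \<otimes> a)) \<otimes> (v \<otimes> (s' \<otimes> a'))" using u v by simp
    also have "\<dots> = (u \<otimes> v) \<otimes> ((s \<otimes> s') \<otimes> (a \<otimes> a'))"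
      using carr a(1) a'(1) by (simp add: m_ac)
    finally show ?thesis
      using assms a a' u v mult_D by (subst frac_eq_iff) (metis m_closed)+
  qed
  have "fr r s \<otimes>\<^bsub>L\<^esub> fr r' s' =
      (\<Union>(a, b)\<in>fr r s. \<Union>(a', b')\<in>fr r' s'. fr (a \<otimes> a') (b \<otimes> b'))"
    by (simp add: localization_def)
  also have "\<dots> = (\<Union>(a, b)\<in>fr r s. \<Union>(a', b')\<in>fr r' s'. fr (r \<otimes> r') (s \<otimes> s'))"
    using * by (intro SUP_cong refl) auto
  also have "\<dots> = fr (r \<otimes> r') (s \<otimes> s')"
    using frac_self[OF assms(1,2)] frac_self[OF assms(3,4)] by auto
  finally show ?thesis .
qed

lemma frac_add:
  assumes "r \<in> carrier R" "s \<in> D" "r' \<in> carrier R" "s' \<in> D"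
  shows "fr r s \<oplus>\<^bsub>L\<^esub> fr r' s' = fr (r \<otimes> s' \<oplus> r' \<otimes> s) (s \<otimes> s')"
proof -
  have *: "fr (a \<otimes> b' \<oplus> a' \<otimes> b) (b \<otimes> b') = fr (r \<otimes> s' \<oplus> r' \<otimes> s) (s \<otimes> s')"
    if ab: "(a, b) \<in> fr r s" and ab': "(a', b') \<in> fr r' s'" for a b a' b'
  proof -
    obtain u where a: "a \<in> carrier R" "b \<in> D" and u: "u \<in> D" "u \<otimes> (b \<otimes> r) = u \<otimes> (s \<otimes> a)"
      using ab unfolding mem_frac by blast
    obtain v where a': "a' \<in> carrier R" "b' \<in> D" and v: "v \<in> D" "v \<otimes> (b' \<otimes> r') = v \<otimes> (s' \<otimes> a')"
      using ab' unfolding mem_frac by blast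
    have carr: "s \<in> carrier R" "s' \<in> carrier R" "b \<in> carrier R" "b' \<in> carrier R" "u \<in> carrier R" "v \<in> carrier R"
      using assms a a' u v by blast+
    have "(u \<otimes> v) \<otimes> ((b \<otimes> b') \<otimes> (r \<otimes> s' \<oplus> r' \<otimes> s))
        = (u \<otimes> (b \<otimes> r)) \<otimes> (v \<otimes> (b' \<otimes> s')) \<oplus> (v \<otimes> (b' \<otimes> r')) \<otimes> (u \<otimes> (b \<otimes> s))"
      using carr assms(1,3) by (simp add: r_distr m_ac)
    also have "\<dots> = (u \<otimes> (s \<otimes> a)) \<otimes> (v \<otimes> (b' \<otimes> s')) \<oplus> (v \<otimes> (s' \<otimes> a')) \<otimes> (u \<otimes> (b \<otimes> s))"
      using u v by simp
    also have "\<dots> = (u \<otimes> v) \<otimes> ((s \<otimes> s') \<otimes> (a \<otimes> b' \<oplus> a' \<otimes> b))"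
      using carr a(1) a'(1) by (simp add: r_distr m_ac)
    finally have eq: "(u \<otimes> v) \<otimes> ((b \<otimes> b') \<otimes> (r \<otimes> s' \<oplus> r' \<otimes> s)) = (u \<otimes> v) \<otimes> ((s \<otimes> s') \<otimes> (a \<otimes> b' \<oplus> a' \<otimes> b))" .
    have "u \<otimes> v \<in> D" "b \<otimes> b' \<in> D" "s \<otimes> s' \<in> D" "a \<otimes> b' \<oplus> a' \<otimes> b \<in> carrier R" "r \<otimes> s' \<oplus> r' \<otimes> s \<in> carrier R"
      using assms a a' u v mult_D carr by blast+
    then show ?thesis
      using eq by (subst frac_eq_iff) metis+
  qed
  have "fr r s \<oplus>\<^bsub>L\<^esub> fr r' s' =
      (\<Union>(a, b)\<in>fr r s. \<Union>(a', b')\<in>fr r' s'. fr (a \<otimes> b' \<oplus> a' \<otimes> b) (b \<otimes> b'))"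
    by (simp add: localization_def)
  also have "\<dots> = (\<Union>(a, b)\<in>fr r s. \<Union>(a', b')\<in>fr r' s'. fr (r \<otimes> s' \<oplus> r' \<otimes> s) (s \<otimes> s'))"
    using * by (intro SUP_cong refl) auto
  also have "\<dots> = fr (r \<otimes> s' \<oplus> r' \<otimes> s) (s \<otimes> s')"
    using frac_self[OF assms(1,2)] frac_self[OF assms(3,4)] by auto
  finally show ?thesis .
qed

lemma frac_add_same:
  assumes "r \<in> carrier R" "r' \<in> carrier R" "s \<in> D"
  shows "fr r s \<oplus>\<^bsub>L\<^esub> fr r' s = fr (r \<oplus> r') s"
proof -
  have s: "s \<in> carrier R" using assms by blast
  have "r \<otimes> s \<oplus> r' \<otimes> s = s \<otimes> (r \<oplus> r')"
    using assms s by (simp add: r_distr m_comm)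
  then have "fr r s \<oplus>\<^bsub>L\<^esub> fr r' s = fr (s \<otimes> (r \<oplus> r')) (s \<otimes> s)"
    using frac_add[OF assms(1,3,2,3)] by simp
  then show ?thesis using assms frac_cancel by simp
qed

lemma localization_one: "\<one>\<^bsub>L\<^esub> = fr \<one> \<one>"
  by (simp add: localization_def)

lemma frac_in_localization: "r \<in> carrier R \<Longrightarrow> s \<in> D \<Longrightarrow> fr r s \<in> carrier L"
  unfolding localization_def by auto

lemma localization_cases:
  assumes "x \<in> carrier L"
  obtains r s where "r \<in> carrier R" "s \<in> D" "x = fr r s"
  using assms unfolding localization_def by auto

lemma frac_zero:
  assumes "s \<in> D"
  shows "fr \<zero> s = \<zero>\<^bsub>L\<^esub>"
proof -
  have "fr \<zero> s = fr \<zero> \<one>" using assms one_D by (intro frac_eqI) auto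
  then show ?thesis by (simp add: localization_def)
qed

lemma frac_eq_zero_iff:
  assumes "r \<in> carrier R" "s \<in> D"
  shows "fr r s = \<zero>\<^bsub>L\<^esub> \<longleftrightarrow> (\<exists>u\<in>D. u \<otimes> r = \<zero>)"
proof -
  have "fr r s = \<zero>\<^bsub>L\<^esub> \<longleftrightarrow> fr r s = fr \<zero> \<one>"
    using frac_zero[OF one_D] by simp
  also have "\<dots> \<longleftrightarrow> (\<exists>u\<in>D. u \<otimes> (\<one> \<otimes> r) = u \<otimes> (s \<otimes> \<zero>))"
    using assms one_D by (intro frac_eq_iff) auto
  also have "\<dots> \<longleftrightarrow> (\<exists>u\<in>D. u \<otimes> r = \<zero>)" using assms by auto
  finally show ?thesis .
qed

lemma frac_one: "s \<in> D \<Longrightarrow> fr s s = \<one>\<^bsub>L\<^esub>"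
  unfolding localization_one using one_D by (intro frac_eqI) auto

lemma cring_localization: "cring L"
proof (rule cringI)
  show "abelian_group L"
  proof (rule abelian_groupI)
    fix x y assume "x \<in> carrier L" "y \<in> carrier L"
    then obtain r s r' s' where *: "r \<in> carrier R" "s \<in> D" "x = fr r s"
        "r' \<in> carrier R" "s' \<in> D" "y = fr r' s'" by (metis localization_cases)
    then have c: "s \<in> carrier R" "s' \<in> carrier R" by blast+
    show "x \<oplus>\<^bsub>L\<^esub> y \<in> carrier L"
      using * c mult_D by (simp add: frac_add frac_in_localization)
    have "r \<otimes> s' \<oplus> r' \<otimes> s = r' \<otimes> s \<oplus> r \<otimes> s'" "s \<otimes> s' = s' \<otimes> s"
      using * c by (simp_all add: a_comm m_comm)
    then show "x \<oplus>\<^bsub>L\<^esub> y = y \<oplus>\<^bsub>L\<^esub> x"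
      using * by (simp add: frac_add)
  next
    fix x y z assume "x \<in> carrier L" "y \<in> carrier L" "z \<in> carrier L"
    then obtain r s r' s' r'' s'' where *: "r \<in> carrier R" "s \<in> D" "x = fr r s"
        "r' \<in> carrier R" "s' \<in> D" "y = fr r' s'" "r'' \<in> carrier R" "s'' \<in> D" "z = fr r'' s''"
      by (metis localization_cases)
    then have c: "s \<in> carrier R" "s' \<in> carrier R" "s'' \<in> carrier R" by blast+
    have "(r \<otimes> s' \<oplus> r' \<otimes> s) \<otimes> s'' \<oplus> r'' \<otimes> (s \<otimes> s')
        = r \<otimes> (s' \<otimes> s'') \<oplus> (r' \<otimes> s'' \<oplus> r'' \<otimes> s') \<otimes> s"
      using *(1,4,7) c by algebra
    moreover have "(x \<oplus>\<^bsub>L\<^esub> y) \<oplus>\<^bsub>L\<^esub> z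
        = fr ((r \<otimes> s' \<oplus> r' \<otimes> s) \<otimes> s'' \<oplus> r'' \<otimes> (s \<otimes> s')) (s \<otimes> s' \<otimes> s'')"
      unfolding *(3,6,9) using * c mult_D[OF *(2,5)] by (simp only: frac_add m_closed a_closed)
    moreover have "x \<oplus>\<^bsub>L\<^esub> (y \<oplus>\<^bsub>L\<^esub> z)
        = fr (r \<otimes> (s' \<otimes> s'') \<oplus> (r' \<otimes> s'' \<oplus> r'' \<otimes> s') \<otimes> s) (s \<otimes> (s' \<otimes> s''))"
      unfolding *(3,6,9) using * c mult_D[OF *(5,8)] by (simp only: frac_add m_closed a_closed)
    ultimately show "x \<oplus>\<^bsub>L\<^esub> y \<oplus>\<^bsub>L\<^esub> z = x \<oplus>\<^bsub>L\<^esub> (y \<oplus>\<^bsub>L\<^esub> z)"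
      using c by (simp only: m_assoc)
  next
    show "\<zero>\<^bsub>L\<^esub> \<in> carrier L"
      using frac_zero[OF one_D] frac_in_localization[OF zero_closed one_D] by simp
    fix x assume "x \<in> carrier L"
    then obtain r s where *: "r \<in> carrier R" "s \<in> D" "x = fr r s" by (metis localization_cases)
    then show "\<zero>\<^bsub>L\<^esub> \<oplus>\<^bsub>L\<^esub> x = x"
      using frac_zero[OF *(2)] frac_add_same[OF zero_closed *(1,2)] by simp
    show "\<exists>y\<in>carrier L. y \<oplus>\<^bsub>L\<^esub> x = \<zero>\<^bsub>L\<^esub>"
    proof
      show "fr (\<ominus> r) s \<oplus>\<^bsub>L\<^esub> x = \<zero>\<^bsub>L\<^esub>"
        using * by (simp add: frac_add_same l_neg frac_zero)
      show "fr (\<ominus> r) s \<in> carrier L" using * by (simp add: frac_in_localization)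
    qed
  qed
  show "comm_monoid L"
  proof (rule comm_monoidI)
    show "\<one>\<^bsub>L\<^esub> \<in> carrier L" unfolding localization_one using one_D frac_in_localization by blast
    fix x y assume "x \<in> carrier L" "y \<in> carrier L"
    then obtain r s r' s' where *: "r \<in> carrier R" "s \<in> D" "x = fr r s"
        "r' \<in> carrier R" "s' \<in> D" "y = fr r' s'" by (metis localization_cases)
    then have c: "s \<in> carrier R" "s' \<in> carrier R" by blast+
    show "x \<otimes>\<^bsub>L\<^esub> y \<in> carrier L"
      using * mult_D by (simp add: frac_mult frac_in_localization)
    have "r \<otimes> r' = r' \<otimes> r" "s \<otimes> s' = s' \<otimes> s" using * c by (simp_all add: m_comm)
    then show "x \<otimes>\<^bsub>L\<^esub> y = y \<otimes>\<^bsub>L\<^esub> x" using * by (simp add: frac_mult)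
  next
    fix x y z assume "x \<in> carrier L" "y \<in> carrier L" "z \<in> carrier L"
    then obtain r s r' s' r'' s'' where *: "r \<in> carrier R" "s \<in> D" "x = fr r s"
        "r' \<in> carrier R" "s' \<in> D" "y = fr r' s'" "r'' \<in> carrier R" "s'' \<in> D" "z = fr r'' s''"
      by (metis localization_cases)
    then have c: "s \<in> carrier R" "s' \<in> carrier R" "s'' \<in> carrier R" by blast+
    have "(x \<otimes>\<^bsub>L\<^esub> y) \<otimes>\<^bsub>L\<^esub> z = fr (r \<otimes> r' \<otimes> r'') (s \<otimes> s' \<otimes> s'')"
      unfolding *(3,6,9) using * mult_D[OF *(2,5)] by (simp only: frac_mult m_closed)
    moreover have "x \<otimes>\<^bsub>L\<^esub> (y \<otimes>\<^bsub>L\<^esub> z) = fr (r \<otimes> (r' \<otimes> r'')) (s \<otimes> (s' \<otimes> s''))"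
      unfolding *(3,6,9) using * mult_D[OF *(5,8)] by (simp only: frac_mult m_closed)
    ultimately show "x \<otimes>\<^bsub>L\<^esub> y \<otimes>\<^bsub>L\<^esub> z = x \<otimes>\<^bsub>L\<^esub> (y \<otimes>\<^bsub>L\<^esub> z)"
      using * c by (simp only: m_assoc)
  next
    fix x assume "x \<in> carrier L"
    then obtain r s where *: "r \<in> carrier R" "s \<in> D" "x = fr r s" by (metis localization_cases)
    then have "s \<in> carrier R" by blast
    then show "\<one>\<^bsub>L\<^esub> \<otimes>\<^bsub>L\<^esub> x = x"
      unfolding localization_one *(3) using * frac_mult[OF one_closed one_D *(1,2)] by simp
  qed
  fix x y z assume "x \<in> carrier L" "y \<in> carrier L" "z \<in> carrier L"
  then obtain r s r' s' r'' s'' where *: "r \<in> carrier R" "s \<in> D" "x = fr r s"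
      "r' \<in> carrier R" "s' \<in> D" "y = fr r' s'" "r'' \<in> carrier R" "s'' \<in> D" "z = fr r'' s''"
    by (metis localization_cases)
  then have c: "s \<in> carrier R" "s' \<in> carrier R" "s'' \<in> carrier R" by blast+
  note den = mult_D[OF *(2,5)] mult_D[OF *(2,8)] mult_D[OF *(5,8)]
  have "(x \<oplus>\<^bsub>L\<^esub> y) \<otimes>\<^bsub>L\<^esub> z = fr ((r \<otimes> s' \<oplus> r' \<otimes> s) \<otimes> r'') (s \<otimes> s' \<otimes> s'')"
    unfolding *(3,6,9) using * c den by (simp only: frac_mult frac_add m_closed a_closed)
  also have "\<dots> = fr (s'' \<otimes> ((r \<otimes> s' \<oplus> r' \<otimes> s) \<otimes> r'')) (s'' \<otimes> (s \<otimes> s' \<otimes> s''))"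
    using * c mult_D[OF den(1) *(8)] by (intro frac_cancel[symmetric]) auto
  also have "s'' \<otimes> ((r \<otimes> s' \<oplus> r' \<otimes> s) \<otimes> r'') = (r \<otimes> r'') \<otimes> (s' \<otimes> s'') \<oplus> (r' \<otimes> r'') \<otimes> (s \<otimes> s'')"
    using * c by (simp add: l_distr r_distr m_ac)
  also have "s'' \<otimes> (s \<otimes> s' \<otimes> s'') = (s \<otimes> s'') \<otimes> (s' \<otimes> s'')"
    using c by (simp add: m_ac)
  also have "fr ((r \<otimes> r'') \<otimes> (s' \<otimes> s'') \<oplus> (r' \<otimes> r'') \<otimes> (s \<otimes> s'')) ((s \<otimes> s'') \<otimes> (s' \<otimes> s''))
      = (x \<otimes>\<^bsub>L\<^esub> z) \<oplus>\<^bsub>L\<^esub> (y \<otimes>\<^bsub>L\<^esub> z)"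
    unfolding *(3,6,9) using * c den by (simp only: frac_mult frac_add m_closed)
  finally show "(x \<oplus>\<^bsub>L\<^esub> y) \<otimes>\<^bsub>L\<^esub> z = (x \<otimes>\<^bsub>L\<^esub> z) \<oplus>\<^bsub>L\<^esub> (y \<otimes>\<^bsub>L\<^esub> z)" .
qed

lemma frac_unit:
  assumes "r \<in> D" "s \<in> D"
  shows "fr r s \<in> Units L"
proof -
  interpret L: cring L by (rule cring_localization)
  have c: "r \<in> carrier R" "s \<in> carrier R" using assms by blast+
  have "fr s r \<otimes>\<^bsub>L\<^esub> fr r s = fr (s \<otimes> r) (s \<otimes> r)"
    using assms c by (simp add: frac_mult m_comm)
  also have "\<dots> = \<one>\<^bsub>L\<^esub>" by (rule frac_one[OF mult_D[OF assms(2,1)]])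
  finally have "fr s r \<otimes>\<^bsub>L\<^esub> fr r s = \<one>\<^bsub>L\<^esub>" .
  moreover have "fr s r \<in> carrier L" "fr r s \<in> carrier L" using assms c frac_in_localization by blast+
  ultimately show ?thesis unfolding Units_def using L.m_comm by fastforce
qed

lemma localization_nonunit_cases:
  assumes "x \<in> carrier L - Units L"
  obtains r s where "r \<in> I" "s \<in> D" "x = fr r s"
  using assms localization_cases frac_unit by (metis Diff_iff)

text \<open>The extension \<open>Q L\<close> of an ideal \<open>Q\<close> of \<open>R\<close> to the localization.\<close>

definition extension :: "'a set \<Rightarrow> ('a \<times> 'a) set set" where
  "extension Q = {fr q s | q s. q \<in> Q \<and> s \<in> D}"

lemma frac_mem_extension_iff:
  assumes Q: "primeideal Q R" "Q \<subseteq> I" and r: "r \<in> carrier R" "s \<in> D"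
  shows "fr r s \<in> extension Q \<longleftrightarrow> r \<in> Q"
proof
  interpret Q: primeideal Q R by (rule Q(1))
  assume "fr r s \<in> extension Q"
  then obtain q t where q: "q \<in> Q" "t \<in> D" "fr r s = fr q t" unfolding extension_def by blast
  have qc: "q \<in> carrier R" using q Q.Icarr by blast
  obtain u where u: "u \<in> D" "u \<otimes> (t \<otimes> r) = u \<otimes> (s \<otimes> q)"
    using q(3) unfolding frac_eq_iff[OF r qc q(2)] by blast
  have "u \<otimes> (s \<otimes> q) \<in> Q" using q(1) r u by (intro Q.I_l_closed) auto
  then have "u \<otimes> (t \<otimes> r) \<in> Q" using u by simp
  then have "u \<in> Q \<or> t \<in> Q \<or> r \<in> Q"
    using Q.I_prime u(1) q(2) r by (meson DiffD1 m_closed)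
  then show "r \<in> Q" using u(1) q(2) Q(2) by blast
next
  assume "r \<in> Q"
  then show "fr r s \<in> extension Q" unfolding extension_def using r by blast
qed

lemma primeideal_extension:
  assumes Q: "primeideal Q R" "Q \<subseteq> I"
  shows "primeideal (extension Q) L"
proof (rule primeidealI2)
  interpret L: cring L by (rule cring_localization)
  interpret Q: primeideal Q R by (rule Q(1))
  note mem = frac_mem_extension_iff[OF Q]
  have cases: "\<exists>q s. q \<in> Q \<and> q \<in> carrier R \<and> s \<in> D \<and> x = fr q s" if "x \<in> extension Q" for x
    using that Q.Icarr unfolding extension_def by blast
  show "cring L" by (rule cring_localization)
  have sub: "extension Q \<subseteq> carrier L" using cases frac_in_localization by blast
  show "additive_subgroup (extension Q) L"
  proof (rule additive_subgroupI, rule L.add.subgroupI)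
    show "extension Q \<subseteq> carrier L" by (rule sub)
    show "extension Q \<noteq> {}" using mem[OF zero_closed one_D] additive_subgroup.zero_closed[OF Q.is_additive_subgroup] by blast
    fix x assume "x \<in> extension Q"
    then obtain q s where x: "q \<in> Q" "q \<in> carrier R" "s \<in> D" "x = fr q s" using cases by blast
    have "fr (\<ominus> q) s \<oplus>\<^bsub>L\<^esub> x = \<zero>\<^bsub>L\<^esub>"
      using x by (simp add: frac_add_same l_neg frac_zero)
    then have "\<ominus>\<^bsub>L\<^esub> x = fr (\<ominus> q) s"
      using x frac_in_localization by (intro L.minus_equality) auto
    moreover have "\<ominus> q \<in> Q" using x(1) by (rule additive_subgroup.a_inv_closed[OF Q.is_additive_subgroup])
    ultimately show "\<ominus>\<^bsub>L\<^esub> x \<in> extension Q" unfolding extension_def using x(3) by blast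
    fix y assume "y \<in> extension Q"
    then obtain r t where y: "r \<in> Q" "r \<in> carrier R" "t \<in> D" "y = fr r t" using cases by blast
    have c: "s \<in> carrier R" "t \<in> carrier R" using x y by blast+
    have "q \<otimes> t \<oplus> r \<otimes> s \<in> Q"
      using x y c by (intro additive_subgroup.a_closed[OF Q.is_additive_subgroup] Q.I_r_closed)
    then show "x \<oplus>\<^bsub>L\<^esub> y \<in> extension Q"
      unfolding extension_def x(4) y(4) frac_add[OF x(2,3) y(2,3)] using mult_D[OF x(3) y(3)] by blast
  qed
  show closed: "x \<otimes>\<^bsub>L\<^esub> a \<in> extension Q" if aQ: "a \<in> extension Q" and xL: "x \<in> carrier L" for a x
  proof -
    obtain q s where a: "q \<in> Q" "q \<in> carrier R" "s \<in> D" "a = fr q s" using aQ cases by blast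
    obtain r t where x: "r \<in> carrier R" "t \<in> D" "x = fr r t" using xL by (rule localization_cases)
    show ?thesis
      unfolding extension_def a(4) x(3) frac_mult[OF x(1,2) a(2,3)]
      using mult_D[OF x(2) a(3)] Q.I_l_closed[OF a(1) x(1)] by blast
  qed
  show "a \<otimes>\<^bsub>L\<^esub> x \<in> extension Q" if "a \<in> extension Q" "x \<in> carrier L" for a x
    using closed[OF that] that sub L.m_comm by fastforce
  have "\<one>\<^bsub>L\<^esub> \<notin> extension Q"
    unfolding localization_one mem[OF one_closed one_D] using one_D Q(2) by blast
  then show "carrier L \<noteq> extension Q" by auto
  fix x y assume "x \<in> carrier L" "y \<in> carrier L" and xy: "x \<otimes>\<^bsub>L\<^esub> y \<in> extension Q"
  then obtain r s r' s' where *: "r \<in> carrier R" "s \<in> D" "x = fr r s"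
      "r' \<in> carrier R" "s' \<in> D" "y = fr r' s'" by (metis localization_cases)
  then have "r \<otimes> r' \<in> Q"
    using xy mem[OF m_closed[OF *(1,4)] mult_D[OF *(2,5)]] by (simp add: frac_mult)
  then show "x \<in> extension Q \<or> y \<in> extension Q"
    using Q.I_prime[OF *(1,4)] mem *  by blast
qed

lemma extension_psubset:
  assumes "primeideal Q R" "Q \<subseteq> I" "primeideal Q' R" "Q' \<subseteq> I" "Q \<subset> Q'"
  shows "extension Q \<subset> extension Q'"
proof -
  obtain q where q: "q \<in> Q'" "q \<notin> Q" using assms(5) by blast
  have "q \<in> carrier R" using q(1) ideal.Icarr[OF primeideal.axioms(1)[OF assms(3)]] by blast
  then have "fr q \<one> \<in> extension Q'" "fr q \<one> \<notin> extension Q"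
    using frac_mem_extension_iff[OF assms(1,2) _ one_D] frac_mem_extension_iff[OF assms(3,4) _ one_D] q by blast+
  moreover have "extension Q \<subseteq> extension Q'" unfolding extension_def using assms(5) by blast
  ultimately show ?thesis by blast
qed

lemma krull_dim_localization_ge_2:
  assumes "primeideal Q R" "primeideal Q' R" "Q \<subset> Q'" "Q' \<subset> I"
  shows "2 \<le> krull_dim L"
proof -
  let ?p = "\<lambda>i::nat. if i = 0 then extension Q else if i = 1 then extension Q' else extension I"
  have "primeideal (?p i) L" for i
    using primeideal_extension[of Q] primeideal_extension[of Q'] primeideal_extension[of I] assms primeideal by auto
  moreover have "?p i \<subset> ?p (Suc i)" if "i < 2" for i
  proof -
    have "i = 0 \<or> i = 1" using that by auto
    then show ?thesis
      using extension_psubset[of Q Q'] extension_psubset[of Q' I] assms primeideal by auto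
  qed
  ultimately have "enat 2 \<le> krull_dim L"
    unfolding krull_dim_def by (intro Sup_upper CollectI exI[of _ "2::nat"] conjI exI[of _ ?p]) auto
  then show ?thesis by (simp add: numeral_eq_enat)
qed

end

text \<open>If \<open>a + b, a' + b'\<close> is a regular sequence, and the products of \<open>a, a'\<close> with \<open>b, b'\<close>
  that occur vanish, then \<open>a (a' + b') = a' (a + b)\<close>. Hence \<open>a = c (a + b)\<close> for some \<open>c\<close>, and
  both terms of \<open>(1 - c) a = c b\<close> are zero because \<open>a + b\<close> is a nonzerodivisor.\<close>

lemma (in cring) regular_pair_split:
  assumes c: "a \<in> carrier R" "b \<in> carrier R" "a' \<in> carrier R" "b' \<in> carrier R"
    and zero: "a \<otimes> b = \<zero>" "a \<otimes> b' = \<zero>" "a' \<otimes> b = \<zero>"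
    and x: "\<And>z. z \<in> carrier R \<Longrightarrow> z \<otimes> (a \<oplus> b) = \<zero> \<Longrightarrow> z = \<zero>"
    and y: "\<And>z w. z \<in> carrier R \<Longrightarrow> w \<in> carrier R \<Longrightarrow> z \<otimes> (a' \<oplus> b') = w \<otimes> (a \<oplus> b) \<Longrightarrow>
      \<exists>w'\<in>carrier R. z = w' \<otimes> (a \<oplus> b)"
  shows "\<exists>c\<in>carrier R. (\<one> \<ominus> c) \<otimes> a = \<zero> \<and> c \<otimes> b = \<zero>"
proof -
  have "a \<otimes> (a' \<oplus> b') = a' \<otimes> (a \<oplus> b)" using c zero by (simp add: r_distr m_comm)
  then obtain w where w: "w \<in> carrier R" "a = w \<otimes> (a \<oplus> b)" using y c by blast
  have eq: "w \<otimes> b = (\<one> \<ominus> w) \<otimes> a"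
  proof -
    have "(\<one> \<ominus> w) \<otimes> a = a \<ominus> w \<otimes> a" using w(1) c by algebra
    also have "\<dots> = w \<otimes> (a \<oplus> b) \<ominus> w \<otimes> a" using w(2) by simp
    also have "\<dots> = w \<otimes> b" using w(1) c by algebra
    finally show ?thesis by simp
  qed
  have ba: "b \<otimes> a = \<zero>" using zero(1) c by (simp add: m_comm)
  have "(w \<otimes> b) \<otimes> (a \<oplus> b) = (w \<otimes> b) \<otimes> b" using w(1) c ba by (simp add: r_distr m_assoc)
  also have "\<dots> = (\<one> \<ominus> w) \<otimes> (a \<otimes> b)" using w(1) c unfolding eq by (simp add: m_assoc)
  also have "\<dots> = \<zero>" using zero w(1) by simp
  finally have "w \<otimes> b = \<zero>" using x w(1) c by blast
  then show ?thesis using eq w(1) by metis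
qed

context primeideal
begin

text \<open>A local ring whose maximal ideal is the sum of two nonzero ideals with product zero has depth
  at most \<open>1\<close>. The ideals enter only through sets \<open>A\<close> and \<open>B\<close> of elements of \<open>R\<close>; the
  elements \<open>\<alpha>\<close> and \<open>\<beta>\<close> witness that they are nonzero after localization.\<close>

lemma local_depth_localization_less_2:
  assumes A: "A \<subseteq> carrier R" and B: "B \<subseteq> carrier R"
    and split: "\<And>p. p \<in> I \<Longrightarrow> \<exists>u\<in>D. \<exists>a\<in>A. \<exists>b\<in>B. u \<otimes> p = a \<oplus> b"
    and zero: "\<And>a b. a \<in> A \<Longrightarrow> b \<in> B \<Longrightarrow> a \<otimes> b = \<zero>"
    and \<alpha>: "\<alpha> \<in> A" "\<And>u. u \<in> D \<Longrightarrow> u \<otimes> \<alpha> \<noteq> \<zero>"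
    and \<beta>: "\<beta> \<in> B" "\<And>u. u \<in> D \<Longrightarrow> u \<otimes> \<beta> \<noteq> \<zero>"
  shows "\<not> 2 \<le> local_depth L"
proof
  interpret L: cring L by (rule cring_localization)
  assume depth: "2 \<le> local_depth L"
  have "\<exists>xs. regular_seq L xs \<and> set xs \<subseteq> carrier L - Units L \<and> 2 \<le> length xs"
  proof (rule ccontr)
    assume "\<not> ?thesis"
    then have "e \<le> enat 1" if "e \<in> {enat (length xs) | xs. regular_seq L xs \<and> set xs \<subseteq> carrier L - Units L}" for e
      using that by fastforce
    then have "local_depth L \<le> enat 1"
      unfolding local_depth_def by (rule Sup_least)
    then have "(2::enat) \<le> enat 1" using depth by (rule order_trans[rotated])
    then show False by (simp add: numeral_eq_enat)
  qed
  then obtain xs where xs: "regular_seq L xs" "set xs \<subseteq> carrier L - Units L" "2 \<le> length xs" by blast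
  obtain x y ys where xy: "xs = x # y # ys"
    using xs(3) by (metis Suc_le_length_iff numeral_2_eq_2)
  have xc: "x \<in> carrier L" "y \<in> carrier L" using xs(2) xy by auto
  have Idl0: "Idl\<^bsub>L\<^esub> {} \<subseteq> {\<zero>\<^bsub>L\<^esub>}" by (rule L.genideal_minimal[OF L.zeroideal]) simp
  have Idl1: "Idl\<^bsub>L\<^esub> {x} = {w \<otimes>\<^bsub>L\<^esub> x | w. w \<in> carrier L}"
    using L.cgenideal_eq_genideal[OF xc(1)] unfolding cgenideal_def by blast
  have reg: "z \<in> Idl\<^bsub>L\<^esub> (set (take i xs))"
    if "i < length xs" "z \<in> carrier L" "z \<otimes>\<^bsub>L\<^esub> xs ! i \<in> Idl\<^bsub>L\<^esub> (set (take i xs))" for i z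
    using xs(1) that unfolding regular_seq_def by blast
  have regx: "z = \<zero>\<^bsub>L\<^esub>" if "z \<in> carrier L" "z \<otimes>\<^bsub>L\<^esub> x = \<zero>\<^bsub>L\<^esub>" for z
  proof -
    have "\<zero>\<^bsub>L\<^esub> \<in> Idl\<^bsub>L\<^esub> {}"
      using L.genideal_ideal[of "{}"] by (simp add: additive_subgroup.zero_closed ideal.axioms(1))
    then have "z \<in> Idl\<^bsub>L\<^esub> {}" using reg[of 0 z] that xy by simp
    then show ?thesis using Idl0 by blast
  qed
  have regy: "\<exists>w'\<in>carrier L. z = w' \<otimes>\<^bsub>L\<^esub> x"
    if "z \<in> carrier L" "w \<in> carrier L" "z \<otimes>\<^bsub>L\<^esub> y = w \<otimes>\<^bsub>L\<^esub> x" for z w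
  proof -
    have "z \<otimes>\<^bsub>L\<^esub> y \<in> Idl\<^bsub>L\<^esub> {x}" unfolding Idl1 using that by blast
    then have "z \<in> Idl\<^bsub>L\<^esub> {x}" using reg[of 1 z] that xy by simp
    then show ?thesis unfolding Idl1 by blast
  qed
  have splitL: "\<exists>a\<in>A. \<exists>b\<in>B. \<exists>s\<in>D. z = fr a s \<oplus>\<^bsub>L\<^esub> fr b s" if zL: "z \<in> carrier L - Units L" for z
  proof -
    obtain p s where p: "p \<in> I" "s \<in> D" "z = fr p s" using zL by (rule localization_nonunit_cases)
    obtain u a b where u: "u \<in> D" "a \<in> A" "b \<in> B" "u \<otimes> p = a \<oplus> b" using split[OF p(1)] by blast
    have "z = fr (u \<otimes> p) (u \<otimes> s)" using frac_cancel[OF Icarr[OF p(1)] p(2) u(1)] p(3) by simp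
    also have "\<dots> = fr a (u \<otimes> s) \<oplus>\<^bsub>L\<^esub> fr b (u \<otimes> s)"
      unfolding u(4) using u A B mult_D[OF u(1) p(2)] by (intro frac_add_same[symmetric]) auto
    finally show ?thesis using u mult_D[OF u(1) p(2)] by blast
  qed
  obtain a b s where ab: "a \<in> A" "b \<in> B" "s \<in> D" "x = fr a s \<oplus>\<^bsub>L\<^esub> fr b s"
    using splitL[of x] xs(2) xy by auto
  obtain a' b' s' where ab': "a' \<in> A" "b' \<in> B" "s' \<in> D" "y = fr a' s' \<oplus>\<^bsub>L\<^esub> fr b' s'"
    using splitL[of y] xs(2) xy by auto
  have zeroL: "fr c t \<otimes>\<^bsub>L\<^esub> fr d t' = \<zero>\<^bsub>L\<^esub>" if "c \<in> A" "d \<in> B" "t \<in> D" "t' \<in> D" for c d t t'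
  proof -
    have "c \<in> carrier R" "d \<in> carrier R" using that A B by blast+
    then show ?thesis using that zero[OF that(1,2)] frac_zero[OF mult_D[OF that(3,4)]] by (simp add: frac_mult)
  qed
  have frA: "fr c t \<in> carrier L" if "c \<in> A \<union> B" "t \<in> D" for c t
    using that A B by (intro frac_in_localization) auto
  have "\<exists>c\<in>carrier L. (\<one>\<^bsub>L\<^esub> \<ominus>\<^bsub>L\<^esub> c) \<otimes>\<^bsub>L\<^esub> fr a s = \<zero>\<^bsub>L\<^esub> \<and> c \<otimes>\<^bsub>L\<^esub> fr b s = \<zero>\<^bsub>L\<^esub>"
  proof (rule L.regular_pair_split[of _ _ "fr a' s'" "fr b' s'"])
    show "\<And>z. z \<in> carrier L \<Longrightarrow> z \<otimes>\<^bsub>L\<^esub> (fr a s \<oplus>\<^bsub>L\<^esub> fr b s) = \<zero>\<^bsub>L\<^esub> \<Longrightarrow> z = \<zero>\<^bsub>L\<^esub>"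
      using regx unfolding ab(4) .
    show "\<And>z w. z \<in> carrier L \<Longrightarrow> w \<in> carrier L \<Longrightarrow>
        z \<otimes>\<^bsub>L\<^esub> (fr a' s' \<oplus>\<^bsub>L\<^esub> fr b' s') = w \<otimes>\<^bsub>L\<^esub> (fr a s \<oplus>\<^bsub>L\<^esub> fr b s) \<Longrightarrow>
        \<exists>w'\<in>carrier L. z = w' \<otimes>\<^bsub>L\<^esub> (fr a s \<oplus>\<^bsub>L\<^esub> fr b s)"
      using regy unfolding ab(4) ab'(4) .
  qed (use ab ab' zeroL frA in auto)
  then obtain c where c: "c \<in> carrier L" "(\<one>\<^bsub>L\<^esub> \<ominus>\<^bsub>L\<^esub> c) \<otimes>\<^bsub>L\<^esub> fr a s = \<zero>\<^bsub>L\<^esub>" "c \<otimes>\<^bsub>L\<^esub> fr b s = \<zero>\<^bsub>L\<^esub>" by blast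
  have unit_zero: "z = \<zero>\<^bsub>L\<^esub>" if "u \<in> Units L" "z \<in> carrier L" "u \<otimes>\<^bsub>L\<^esub> z = \<zero>\<^bsub>L\<^esub>" for u z
    using that L.Units_l_cancel[OF that(1,2) L.zero_closed] L.Units_closed by simp
  \<comment> \<open>As the localization is local, \<open>c\<close> or \<open>1 - c\<close> is a unit.\<close>
  have "c \<in> Units L \<or> \<one>\<^bsub>L\<^esub> \<ominus>\<^bsub>L\<^esub> c \<in> Units L"
  proof (rule ccontr)
    assume "\<not> ?thesis"
    then obtain r t r' t' where r: "r \<in> I" "t \<in> D" "c = fr r t"
      and r': "r' \<in> I" "t' \<in> D" "\<one>\<^bsub>L\<^esub> \<ominus>\<^bsub>L\<^esub> c = fr r' t'"
      using c(1) by (metis DiffI L.minus_closed L.one_closed localization_nonunit_cases)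
    have cr: "r \<in> carrier R" "r' \<in> carrier R" using r(1) r'(1) Icarr by blast+
    have "\<one>\<^bsub>L\<^esub> = c \<oplus>\<^bsub>L\<^esub> (\<one>\<^bsub>L\<^esub> \<ominus>\<^bsub>L\<^esub> c)" using c(1) by algebra
    also have "\<dots> = fr (r \<otimes> t' \<oplus> r' \<otimes> t) (t \<otimes> t')"
      unfolding r'(3) unfolding r(3) using r r' cr by (simp add: frac_add)
    finally have "\<one>\<^bsub>L\<^esub> \<in> extension I"
      unfolding extension_def using r r' mult_D[OF r(2) r'(2)] I_r_closed by blast
    then show False
      unfolding localization_one frac_mem_extension_iff[OF primeideal order.refl one_closed one_D]
      using one_D by blast
  qed
  then show False
  proof
    assume "c \<in> Units L"
    then have "fr b s = \<zero>\<^bsub>L\<^esub>" using unit_zero c(3) frA ab by blast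
    then have "x = fr a s" using ab frA by simp
    then have "fr \<beta> \<one> \<otimes>\<^bsub>L\<^esub> x = \<zero>\<^bsub>L\<^esub>"
      using zeroL[OF ab(1) \<beta>(1) ab(3) one_D] frA[of a s] frA[of \<beta> \<one>] ab \<beta> one_D L.m_comm by auto
    then have "fr \<beta> \<one> = \<zero>\<^bsub>L\<^esub>" using regx frA[of \<beta> \<one>] \<beta> one_D by blast
    then show False using frac_eq_zero_iff[of \<beta> \<one>] \<beta> B one_D by blast
  next
    assume "\<one>\<^bsub>L\<^esub> \<ominus>\<^bsub>L\<^esub> c \<in> Units L"
    then have "fr a s = \<zero>\<^bsub>L\<^esub>" using unit_zero c(2) frA ab by blast
    then have "x = fr b s" using ab frA by simp
    then have "fr \<alpha> \<one> \<otimes>\<^bsub>L\<^esub> x = \<zero>\<^bsub>L\<^esub>"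
      using zeroL[OF \<alpha>(1) ab(2) one_D ab(3)] by simp
    then have "fr \<alpha> \<one> = \<zero>\<^bsub>L\<^esub>" using regx frA[of \<alpha> \<one>] \<alpha> one_D by blast
    then show False using frac_eq_zero_iff[of \<alpha> \<one>] \<alpha> A one_D by blast
  qed
qed

end

section \<open>Prime ideals of quotient rings\<close>

lemma (in ideal) a_rcos_eq_iff:
  assumes "p \<in> carrier R" "q \<in> carrier R"
  shows "I +> p = I +> q \<longleftrightarrow> p \<ominus> q \<in> I"
  using quotient_eq_iff_same_a_r_cos[OF is_ideal assms] by blast

lemma (in ideal) quotient_simps:
  assumes "p \<in> carrier R" "q \<in> carrier R"
  shows "(I +> p) \<oplus>\<^bsub>R Quot I\<^esub> (I +> q) = I +> (p \<oplus> q)"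
    and "(I +> p) \<otimes>\<^bsub>R Quot I\<^esub> (I +> q) = I +> (p \<otimes> q)"
    and "I +> p = \<zero>\<^bsub>R Quot I\<^esub> \<longleftrightarrow> p \<in> I"
proof -
  show "(I +> p) \<oplus>\<^bsub>R Quot I\<^esub> (I +> q) = I +> (p \<oplus> q)"
    using assms by (simp add: FactRing_def a_rcos_sum)
  show "(I +> p) \<otimes>\<^bsub>R Quot I\<^esub> (I +> q) = I +> (p \<otimes> q)"
    using assms by (simp add: FactRing_def rcoset_mult_add)
  show "I +> p = \<zero>\<^bsub>R Quot I\<^esub> \<longleftrightarrow> p \<in> I"
    using rcos_const_imp_mem[OF assms(1)] a_rcos_zero[OF is_ideal] by (auto simp: FactRing_def)
qed

lemma (in ideal) carrier_quotient: "carrier (R Quot I) = (+>) I ` carrier R"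
  unfolding FactRing_def A_RCOSETS_defs a_r_coset_def by auto

lemma (in ideal) mem_quotient_image_iff:
  assumes "ideal P R" "I \<subseteq> P" "p \<in> carrier R"
  shows "I +> p \<in> (+>) I ` P \<longleftrightarrow> p \<in> P"
proof
  interpret P: ideal P R by (rule assms)
  assume "I +> p \<in> (+>) I ` P"
  then obtain q where q: "q \<in> P" "I +> p = I +> q" by blast
  have qc: "q \<in> carrier R" using q(1) P.Icarr by blast
  have "p \<ominus> q \<in> P" using q(2) a_rcos_eq_iff[OF assms(3) qc] assms(2) by blast
  then have "(p \<ominus> q) \<oplus> q \<in> P" using q(1) by (rule P.a_closed)
  moreover have "(p \<ominus> q) \<oplus> q = p" using assms(3) qc by algebra
  ultimately show "p \<in> P" by simp
qed blast

lemma (in ideal) primeideal_quotient: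
  assumes P: "primeideal P R" "I \<subseteq> P"
  shows "primeideal ((+>) I ` P) (R Quot I)"
proof (rule primeidealI)
  interpret P: primeideal P R by (rule P(1))
  show "ideal ((+>) I ` P) (R Quot I)" by (rule ring_ideal_imp_quot_ideal[OF is_ideal P.is_ideal])
  show "cring (R Quot I)" by (rule quotient_is_cring[OF P.is_cring])
  note mem = mem_quotient_image_iff[OF P.is_ideal P(2)]
  have "\<one> \<notin> P" using P.one_imp_carrier P.I_notcarr by blast
  then have "I +> \<one> \<notin> (+>) I ` P" using mem[OF one_closed] by blast
  then show "carrier (R Quot I) \<noteq> (+>) I ` P" unfolding carrier_quotient by blast
  fix a b assume "a \<in> carrier (R Quot I)" "b \<in> carrier (R Quot I)" and ab: "a \<otimes>\<^bsub>R Quot I\<^esub> b \<in> (+>) I ` P"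
  then obtain p q where p: "p \<in> carrier R" "q \<in> carrier R" "a = I +> p" "b = I +> q"
    unfolding carrier_quotient by blast
  have "p \<otimes> q \<in> P" using ab unfolding p(3,4) quotient_simps(2)[OF p(1,2)] mem[OF m_closed[OF p(1,2)]] .
  then show "a \<in> (+>) I ` P \<or> b \<in> (+>) I ` P" using P.I_prime[OF p(1,2)] p(3,4) by blast
qed

section \<open>Serre's condition and connectedness of links\<close>

text \<open>The prime ideal generated by the variables outside \<open>F\<close>, described by its monomials.\<close>

definition face_ideal :: "'k::field itself \<Rightarrow> 'v set \<Rightarrow> 'v set \<Rightarrow> (('v \<Rightarrow>\<^sub>0 nat) \<Rightarrow>\<^sub>0 'k) set" where
  "face_ideal K V F =
     {p \<in> carrier (polynomial_ring K V). \<forall>k\<in>Poly_Mapping.keys p. \<not> Poly_Mapping.keys k \<subseteq> F}"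

text \<open>The part of a polynomial consisting of the terms whose monomials satisfy \<open>T\<close>.\<close>

definition poly_restrict :: "('m \<Rightarrow> bool) \<Rightarrow> ('m \<Rightarrow>\<^sub>0 'k::comm_monoid_add) \<Rightarrow> ('m \<Rightarrow>\<^sub>0 'k)" where
  "poly_restrict T p = (\<Sum>k\<in>{k \<in> Poly_Mapping.keys p. T k}. Poly_Mapping.single k (Poly_Mapping.lookup p k))"

lemma lookup_poly_restrict: "Poly_Mapping.lookup (poly_restrict T p) k = (if T k then Poly_Mapping.lookup p k else 0)"
proof -
  have "Poly_Mapping.lookup (poly_restrict T p) k
      = (\<Sum>j\<in>{j \<in> Poly_Mapping.keys p. T j}. if j = k then Poly_Mapping.lookup p j else 0)"
    unfolding poly_restrict_def by (simp add: lookup_sum lookup_single when_def)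
  also have "\<dots> = (if T k then Poly_Mapping.lookup p k else 0)"
    by (simp add: in_keys_iff)
  finally show ?thesis .
qed

lemma keys_poly_restrict: "Poly_Mapping.keys (poly_restrict T p) = {k \<in> Poly_Mapping.keys p. T k}"
  unfolding set_eq_iff mem_Collect_eq in_keys_iff by (simp add: lookup_poly_restrict)

lemma poly_restrict_split: "p = poly_restrict T p + poly_restrict (\<lambda>k. \<not> T k) p"
  by (rule poly_mapping_eqI) (simp add: lookup_add lookup_poly_restrict)

lemma poly_restrict_in_ring:
  "p \<in> carrier (polynomial_ring K V) \<Longrightarrow> poly_restrict T p \<in> carrier (polynomial_ring K V)"
  unfolding mem_polynomial_ring keys_poly_restrict by blast

lemma primeideal_face_ideal:
  fixes V :: "'v::linorder set" and K :: "'k::field itself"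
  shows "primeideal (face_ideal K V F) (polynomial_ring K V)"
proof (rule primeidealI)
  show "cring (polynomial_ring K V)" by (rule cring_polynomial_ring)
  show ideal: "ideal (face_ideal K V F) (polynomial_ring K V)"
  proof (rule ideal_polynomial_ringI)
    fix p q assume "p \<in> face_ideal K V F" "q \<in> face_ideal K V F"
    then show "p + q \<in> face_ideal K V F"
      using keys_add[of p q] add_in_PR[of p K V q] unfolding face_ideal_def by blast
  next
    fix p c assume p: "p \<in> face_ideal K V F" and c: "c \<in> carrier (polynomial_ring K V)"
    have "\<not> Poly_Mapping.keys m \<subseteq> F" if m: "m \<in> Poly_Mapping.keys (c * p)" for m
    proof -
      obtain a b where "m = a + b" "b \<in> Poly_Mapping.keys p" using keys_mult[of c p] m by blast
      then show ?thesis using p by (auto simp: face_ideal_def keys_add_nat)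
    qed
    then show "c * p \<in> face_ideal K V F"
      using p mult_in_PR[OF c, of p] unfolding face_ideal_def by blast
  qed (auto simp: face_ideal_def zero_in_PR)
  have "1 \<notin> face_ideal K V F" by (simp add: face_ideal_def)
  then show "carrier (polynomial_ring K V) \<noteq> face_ideal K V F" using one_in_PR by blast
  fix p q assume pq: "p \<in> carrier (polynomial_ring K V)" "q \<in> carrier (polynomial_ring K V)"
    "p \<otimes>\<^bsub>polynomial_ring K V\<^esub> q \<in> face_ideal K V F"
  let ?T = "\<lambda>k. \<not> Poly_Mapping.keys k \<subseteq> F"
  let ?U = "\<lambda>k. \<not> \<not> Poly_Mapping.keys k \<subseteq> F"
  have part: "poly_restrict ?T r \<in> face_ideal K V F" if "r \<in> carrier (polynomial_ring K V)" for r
    using poly_restrict_in_ring[OF that] by (simp add: face_ideal_def keys_poly_restrict)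
  show "p \<in> face_ideal K V F \<or> q \<in> face_ideal K V F"
  proof (rule ccontr)
    assume "\<not> ?thesis"
    then have "\<not> (\<forall>k\<in>Poly_Mapping.keys p. ?T k)" "\<not> (\<forall>k\<in>Poly_Mapping.keys q. ?T k)"
      using pq unfolding face_ideal_def by blast+
    then have "Poly_Mapping.keys (poly_restrict ?U p) \<noteq> {}" "Poly_Mapping.keys (poly_restrict ?U q) \<noteq> {}"
      unfolding keys_poly_restrict by blast+
    then have ne: "poly_restrict ?U p \<noteq> 0" "poly_restrict ?U q \<noteq> 0" by auto
    \<comment> \<open>The linear order on the variables makes the type of polynomials an integral domain.\<close>
    then have "poly_restrict ?U p * poly_restrict ?U q \<noteq> 0" by simp
    then obtain m where m: "m \<in> Poly_Mapping.keys (poly_restrict ?U p * poly_restrict ?U q)"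
      by (metis keys_eq_empty ex_in_conv)
    note J = ideal_polynomial_ringD[OF ideal]
    have split: "poly_restrict ?U r = r - poly_restrict ?T r" for r :: "('v \<Rightarrow>\<^sub>0 nat) \<Rightarrow>\<^sub>0 'k"
      using poly_restrict_split[of r ?T] by (simp add: eq_diff_eq add.commute)
    have eq: "poly_restrict ?U p * poly_restrict ?U q
        = p * q + (- 1) * (q * poly_restrict ?T p + poly_restrict ?U p * poly_restrict ?T q)"
      unfolding split by (simp add: algebra_simps)
    have "q * poly_restrict ?T p + poly_restrict ?U p * poly_restrict ?T q \<in> face_ideal K V F"
      by (intro J(3,4) part pq poly_restrict_in_ring)
    from J(4)[OF this uminus_in_PR[OF one_in_PR]]
    have "(- 1) * (q * poly_restrict ?T p + poly_restrict ?U p * poly_restrict ?T q) \<in> face_ideal K V F" .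
    then have "poly_restrict ?U p * poly_restrict ?U q \<in> face_ideal K V F"
      unfolding eq using pq(3) by (intro J(3)) simp_all
    then have "\<not> Poly_Mapping.keys m \<subseteq> F" using m unfolding face_ideal_def by blast
    moreover obtain a b where "m = a + b" "a \<in> Poly_Mapping.keys (poly_restrict ?U p)" "b \<in> Poly_Mapping.keys (poly_restrict ?U q)"
      using keys_mult[of "poly_restrict ?U p" "poly_restrict ?U q"] m by blast
    ultimately show False by (simp add: keys_add_nat keys_poly_restrict)
  qed
qed

theorem connected_links_if_serre_S2:
  fixes K :: "'k::field itself" and \<Delta> :: "'v::linorder set set"
  assumes cpx: "finite_complex \<Delta>" and S2: "serre_S2 (stanley_reisner_ring K (\<Union>\<Delta>) \<Delta>)"
  shows "connected_links \<Delta>"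
  unfolding connected_links_def
proof (intro ballI impI)
  fix F assume F: "F \<in> \<Delta>" and dim: "1 \<le> complex_dim (link \<Delta> F)"
  let ?V = "\<Union>\<Delta>"
  let ?S = "polynomial_ring K ?V"
  let ?I = "stanley_reisner_ideal K ?V \<Delta>"
  let ?R = "?S Quot ?I"
  let ?P = "face_ideal K ?V"
  let ?\<pi> = "(+>\<^bsub>?S\<^esub>) ?I"
  interpret S: cring ?S by (rule cring_polynomial_ring)
  have "{squarefree_monomial G | G. G \<subseteq> ?V \<and> G \<notin> \<Delta>} \<subseteq> carrier ?S"
  proof
    fix x assume "x \<in> {squarefree_monomial G :: ('v \<Rightarrow>\<^sub>0 nat) \<Rightarrow>\<^sub>0 'k | G. G \<subseteq> ?V \<and> G \<notin> \<Delta>}"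
    then obtain G where G: "x = squarefree_monomial G" "G \<subseteq> ?V" by blast
    have "finite G" using G(2) finite_vertices[OF cpx] by (rule finite_subset)
    then show "x \<in> carrier ?S"
      using G unfolding squarefree_monomial_eq by (auto simp: keys_indicator_monomial intro!: single_in_PR)
  qed
  then interpret I: ideal ?I ?S unfolding stanley_reisner_ideal_def by (rule S.genideal_ideal)
  interpret lnk: cring ?R by (rule I.quotient_is_cring[OF S.is_cring])
  note I_eq = stanley_reisner_ideal_eq[OF cpx, of K]
  have lcpx: "finite_complex (link \<Delta> F)" by (rule finite_complex_link[OF cpx F])
  have IP: "?I \<subseteq> ?P G" if "G \<in> \<Delta>" for G
    using face_subset[OF cpx that] unfolding I_eq face_ideal_def by blast
  have prime: "primeideal (?\<pi> ` ?P G) ?R" if "G \<in> \<Delta>" for G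
    by (rule I.primeideal_quotient[OF primeideal_face_ideal IP[OF that]])
  have mem: "?\<pi> p \<in> ?\<pi> ` ?P G \<longleftrightarrow> p \<in> ?P G" if "G \<in> \<Delta>" "p \<in> carrier ?S" for G p
    by (rule I.mem_quotient_image_iff[OF primeideal.axioms(1)[OF primeideal_face_ideal] IP[OF that(1)] that(2)])
  interpret P: primeideal "?\<pi> ` ?P F" ?R by (rule prime[OF F])
  have finF: "finite F" by (rule finite_face[OF cpx F])
  have ins: "insert v F \<in> \<Delta>" "v \<in> ?V" "v \<notin> F" if v: "v \<in> \<Union>(link \<Delta> F)" for v
  proof -
    obtain G where G: "v \<in> G" "G \<in> link \<Delta> F" using v by blast
    then have G': "G \<union> F \<in> \<Delta>" "G \<inter> F = {}" unfolding link_iff[OF cpx] by blast+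
    show "insert v F \<in> \<Delta>" by (rule face_subset[OF cpx G'(1)]) (use G in blast)
    then show "v \<in> ?V" by blast
    show "v \<notin> F" using G G' by blast
  qed
  have mon: "Poly_Mapping.single (indicator_monomial G) 1 \<in> carrier ?S" if "G \<in> \<Delta>" for G
    using that finite_face[OF cpx that] by (intro single_in_PR) (auto simp: keys_indicator_monomial)

  \<comment> \<open>The dimension of the localization at the face ideal of \<open>F\<close> is at least 2.\<close>
  obtain G where G: "G \<in> link \<Delta> F" "face_dim G = complex_dim (link \<Delta> F)" using max_face[OF lcpx] by blast
  then have "2 \<le> card G" using dim unfolding face_dim_def by linarith
  then obtain v w where vw: "v \<in> G" "w \<in> G" "v \<noteq> w"
    by (metis card_2_iff' card_le_Suc0_iff_eq card.infinite nat_le_linear not_less_eq_eq numeral_2_eq_2 zero_neq_numeral le_zero_eq)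
  have Fvw: "insert w (insert v F) \<in> \<Delta>" "v \<notin> F" "w \<notin> F"
    using G(1) vw face_subset[OF cpx, of "G \<union> F" "insert w (insert v F)"] unfolding link_iff[OF cpx] by blast+
  have Fv: "insert v F \<in> \<Delta>" using Fvw(1) by (rule face_subset[OF cpx]) blast
  have psub: "?\<pi> ` ?P (insert x H) \<subset> ?\<pi> ` ?P H" if H: "insert x H \<in> \<Delta>" "x \<notin> H" for x H
  proof -
    have "H \<in> \<Delta>" using H(1) by (rule face_subset[OF cpx]) blast
    have x: "{x} \<in> \<Delta>" using H(1) by (rule face_subset[OF cpx]) blast
    let ?m = "Poly_Mapping.single (indicator_monomial {x}) (1::'k)"
    have "?m \<in> ?P H" "?m \<notin> ?P (insert x H)"
      using H(2) mon[OF x] by (simp_all add: face_ideal_def keys_indicator_monomial)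
    then have "?\<pi> ?m \<in> ?\<pi> ` ?P H" "?\<pi> ?m \<notin> ?\<pi> ` ?P (insert x H)"
      using mem[OF \<open>H \<in> \<Delta>\<close> mon[OF x]] mem[OF H(1) mon[OF x]] by blast+
    moreover have "?P (insert x H) \<subseteq> ?P H" unfolding face_ideal_def by blast
    ultimately show ?thesis by blast
  qed
  have "w \<notin> insert v F" using Fvw(3) vw(3) by simp
  then have "2 \<le> krull_dim (localization ?R (?\<pi> ` ?P F))"
    by (intro P.krull_dim_localization_ge_2[OF prime[OF Fvw(1)] prime[OF Fv]] psub Fvw Fv)
  then have depth: "2 \<le> local_depth (localization ?R (?\<pi> ` ?P F))"
    using S2 P.primeideal unfolding serre_S2_def stanley_reisner_ring_def by (metis min_absorb2)

  show "connected_complex (link \<Delta> F)"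
    unfolding connected_complex_def
  proof (intro allI impI, rule ccontr)
    fix A assume A: "A \<subseteq> \<Union>(link \<Delta> F)" "A \<noteq> {}" "\<forall>a\<in>A. \<forall>b. {a, b} \<in> link \<Delta> F \<longrightarrow> b \<in> A"
      and "A \<noteq> \<Union>(link \<Delta> F)"
    define B where "B = \<Union>(link \<Delta> F) - A"
    have B: "B \<subseteq> \<Union>(link \<Delta> F)" "B \<noteq> {}" using A \<open>A \<noteq> \<Union>(link \<Delta> F)\<close> unfolding B_def by blast+
    have sep: "H \<notin> \<Delta>" if H: "F \<subseteq> H" "a \<in> A" "a \<in> H" "b \<in> B" "b \<in> H" for H a b
    proof
      assume "H \<in> \<Delta>"
      have "{a, b} \<inter> F = {}" using H A(1) B(1) ins(3) by blast
      moreover have "{a, b} \<union> F \<in> \<Delta>" using \<open>H \<in> \<Delta>\<close> by (rule face_subset[OF cpx]) (use H in blast)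
      ultimately have "{a, b} \<in> link \<Delta> F" unfolding link_iff[OF cpx] by blast
      then show False using A(3) H unfolding B_def by blast
    qed
    \<comment> \<open>Multiples of the monomial of \<open>F\<close>, a unit in the localization, that also involve a variable
      from \<open>C\<close> in each term.\<close>
    define part where "part C = {p \<in> carrier ?S. \<forall>k\<in>Poly_Mapping.keys p.
        F \<subseteq> Poly_Mapping.keys k \<and> Poly_Mapping.keys k \<inter> C \<noteq> {}}" for C
    have partS: "part C \<subseteq> carrier ?S" for C unfolding part_def by blast
    have nonzero: "\<exists>\<gamma>\<in>?\<pi> ` part C. \<forall>u\<in>carrier ?R - ?\<pi> ` ?P F. u \<otimes>\<^bsub>?R\<^esub> \<gamma> \<noteq> \<zero>\<^bsub>?R\<^esub>"
      if C: "C \<subseteq> \<Union>(link \<Delta> F)" "C \<noteq> {}" for C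
    proof -
      obtain c where c: "c \<in> C" using C by blast
      have cF: "insert c F \<in> \<Delta>" using ins(1) c C by blast
      let ?m = "indicator_monomial (insert c F)"
      let ?g = "Poly_Mapping.single ?m (1::'k)"
      have km: "Poly_Mapping.keys ?m = insert c F" by (rule keys_indicator_monomial) (simp add: finF)
      have g: "?g \<in> part C" using mon[OF cF] c by (auto simp: part_def km)
      have "u \<otimes>\<^bsub>?R\<^esub> ?\<pi> ?g \<noteq> \<zero>\<^bsub>?R\<^esub>" if u: "u \<in> carrier ?R - ?\<pi> ` ?P F" for u
      proof -
        obtain q where q: "q \<in> carrier ?S" "u = ?\<pi> q" using u unfolding I.carrier_quotient by blast
        have "q \<notin> ?P F" using u mem[OF F q(1)] q(2) by blast
        then obtain k where k: "k \<in> Poly_Mapping.keys q" "Poly_Mapping.keys k \<subseteq> F"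
          using q(1) unfolding face_ideal_def by blast
        have "k + ?m \<in> Poly_Mapping.keys (q * ?g)"
          using k(1) by (simp add: in_keys_iff lookup_mult_single)
        moreover have "Poly_Mapping.keys (k + ?m) = insert c F" using k(2) by (auto simp: keys_add_nat km)
        ultimately have "q * ?g \<notin> ?I" using cF unfolding I_eq by (metis (mono_tags, lifting) mem_Collect_eq)
        then show ?thesis
          unfolding q(2) using I.quotient_simps[OF q(1) mon[OF cF]]
            I.quotient_simps(3)[OF S.m_closed[OF q(1) mon[OF cF]] q(1)] by simp
      qed
      then show ?thesis using g by blast
    qed
    obtain \<alpha> where \<alpha>: "\<alpha> \<in> ?\<pi> ` part A" "\<forall>u\<in>carrier ?R - ?\<pi> ` ?P F. u \<otimes>\<^bsub>?R\<^esub> \<alpha> \<noteq> \<zero>\<^bsub>?R\<^esub>"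
      using nonzero[OF A(1,2)] by (rule bexE)
    obtain \<beta> where \<beta>: "\<beta> \<in> ?\<pi> ` part B" "\<forall>u\<in>carrier ?R - ?\<pi> ` ?P F. u \<otimes>\<^bsub>?R\<^esub> \<beta> \<noteq> \<zero>\<^bsub>?R\<^esub>"
      using nonzero[OF B] by (rule bexE)
    have "\<not> 2 \<le> local_depth (localization ?R (?\<pi> ` ?P F))"
    proof (rule P.local_depth_localization_less_2[OF _ _ _ _ \<alpha>(1) bspec[OF \<alpha>(2)] \<beta>(1) bspec[OF \<beta>(2)]])
      show "?\<pi> ` part A \<subseteq> carrier ?R" "?\<pi> ` part B \<subseteq> carrier ?R"
        unfolding I.carrier_quotient using partS by blast+
    next
      fix a b assume "a \<in> ?\<pi> ` part A" "b \<in> ?\<pi> ` part B"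
      then obtain p q where p: "p \<in> part A" "q \<in> part B" "a = ?\<pi> p" "b = ?\<pi> q" by blast
      have S: "p \<in> carrier ?S" "q \<in> carrier ?S" using p partS by blast+
      have "Poly_Mapping.keys m \<notin> \<Delta>" if m: "m \<in> Poly_Mapping.keys (p * q)" for m
      proof -
        obtain k l where kl: "m = k + l" "k \<in> Poly_Mapping.keys p" "l \<in> Poly_Mapping.keys q"
          using keys_mult[of p q] m by blast
        obtain x y where "x \<in> Poly_Mapping.keys k" "x \<in> A" "y \<in> Poly_Mapping.keys l" "y \<in> B"
          using p kl unfolding part_def by blast
        moreover have "F \<subseteq> Poly_Mapping.keys k" using p(1) kl(2) unfolding part_def by blast
        ultimately show ?thesis unfolding kl(1) keys_add_nat by (intro sep[of _ x y]) auto
      qed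
      then have "p * q \<in> ?I" using mult_in_PR[OF S] unfolding I_eq by blast
      then show "a \<otimes>\<^bsub>?R\<^esub> b = \<zero>\<^bsub>?R\<^esub>"
        unfolding p(3,4) I.quotient_simps(2)[OF S] I.quotient_simps(3)[OF S.m_closed[OF S] S(1)] by simp
    next
      fix y assume "y \<in> ?\<pi> ` ?P F"
      then obtain p where p: "p \<in> ?P F" "y = ?\<pi> p" by blast
      have pS: "p \<in> carrier ?S" using p(1) unfolding face_ideal_def by blast
      let ?u = "Poly_Mapping.single (indicator_monomial F) (1::'k)"
      have uS: "?u \<in> carrier ?S" by (rule mon[OF F])
      have "?u \<notin> ?P F" by (simp add: face_ideal_def keys_indicator_monomial[OF finF])
      then have u: "?\<pi> ?u \<in> carrier ?R - ?\<pi> ` ?P F"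
        using mem[OF F uS] uS unfolding I.carrier_quotient by blast
      \<comment> \<open>Split this product into the terms that involve \<open>A\<close>, those of the others that involve \<open>B\<close>,
        and the rest, which is supported on nonfaces.\<close>
      define q where "q = ?u * p"
      have qS: "q \<in> carrier ?S" unfolding q_def by (rule mult_in_PR[OF uS pS])
      have kq: "F \<subseteq> Poly_Mapping.keys m" "\<not> Poly_Mapping.keys m \<subseteq> F" if m: "m \<in> Poly_Mapping.keys q" for m
      proof -
        obtain k l where kl: "m = k + l" "k \<in> Poly_Mapping.keys ?u" "l \<in> Poly_Mapping.keys p"
          using keys_mult[of ?u p] m unfolding q_def by blast
        have "Poly_Mapping.keys k = F" using kl(2) by (simp add: keys_indicator_monomial[OF finF])
        then show "F \<subseteq> Poly_Mapping.keys m" "\<not> Poly_Mapping.keys m \<subseteq> F"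
          using kl(1,3) p(1) unfolding face_ideal_def by (auto simp: keys_add_nat)
      qed
      let ?TA = "\<lambda>k. Poly_Mapping.keys k \<inter> A \<noteq> {}"
      let ?TB = "\<lambda>k. Poly_Mapping.keys k \<inter> B \<noteq> {}"
      define a where "a = poly_restrict ?TA q"
      define r where "r = poly_restrict (\<lambda>k. \<not> ?TA k) q"
      define b where "b = poly_restrict ?TB r"
      define c where "c = poly_restrict (\<lambda>k. \<not> ?TB k) r"
      have abcS: "a \<in> carrier ?S" "b \<in> carrier ?S" "c \<in> carrier ?S"
        unfolding a_def b_def c_def r_def by (intro poly_restrict_in_ring qS)+
      have q: "q = a + (b + c)"
        using poly_restrict_split[of q ?TA] poly_restrict_split[of r ?TB]
        unfolding a_def b_def c_def r_def by simp
      have aA: "a \<in> part A" using abcS kq unfolding part_def a_def by (simp add: keys_poly_restrict)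
      have bB: "b \<in> part B" using abcS kq unfolding part_def b_def r_def by (simp add: keys_poly_restrict)
      have "Poly_Mapping.keys m \<notin> \<Delta>" if m: "m \<in> Poly_Mapping.keys c" for m
      proof
        assume "Poly_Mapping.keys m \<in> \<Delta>"
        have mq: "m \<in> Poly_Mapping.keys q" "Poly_Mapping.keys m \<inter> A = {}" "Poly_Mapping.keys m \<inter> B = {}"
          using m unfolding c_def r_def keys_poly_restrict by blast+
        have "Poly_Mapping.keys m - F \<union> F = Poly_Mapping.keys m" using kq(1)[OF mq(1)] by blast
        then have "Poly_Mapping.keys m - F \<in> link \<Delta> F"
          using \<open>Poly_Mapping.keys m \<in> \<Delta>\<close> unfolding link_iff[OF cpx] by auto
        then have "Poly_Mapping.keys m - F \<subseteq> A \<union> B" unfolding B_def by blast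
        then show False using mq kq(2)[OF mq(1)] by blast
      qed
      then have cI: "c \<in> ?I" using abcS unfolding I_eq by blast
      have "?\<pi> (b + c) = ?\<pi> b"
      proof -
        have "(b \<oplus>\<^bsub>?S\<^esub> c) \<ominus>\<^bsub>?S\<^esub> b = c" using abcS by algebra
        then show ?thesis
          using cI I.a_rcos_eq_iff[OF S.a_closed[OF abcS(2,3)] abcS(2)] by simp
      qed
      then have "?\<pi> q = ?\<pi> a \<oplus>\<^bsub>?R\<^esub> ?\<pi> b"
        using I.quotient_simps(1)[OF abcS(1) S.a_closed[OF abcS(2,3)]] q by simp
      then have "?\<pi> ?u \<otimes>\<^bsub>?R\<^esub> y = ?\<pi> a \<oplus>\<^bsub>?R\<^esub> ?\<pi> b"
        unfolding p(2) using I.quotient_simps(2)[OF uS pS] q_def by simp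
      then show "\<exists>u\<in>carrier ?R - ?\<pi> ` ?P F. \<exists>a\<in>?\<pi> ` part A. \<exists>b\<in>?\<pi> ` part B. u \<otimes>\<^bsub>?R\<^esub> y = a \<oplus>\<^bsub>?R\<^esub> b"
        using u aA bB by blast
    qed
    then show False using depth by blast
  qed
qed

section \<open>The equivalence\<close>

theorem corollary1p10:
  fixes n :: nat and \<Delta> :: "nat set set"
  assumes complex: "simplicial_complex {1..n} \<Delta>"
    and dim: "complex_dim \<Delta> \<ge> 2"
    and S2: "serre_S2 (stanley_reisner_ring TYPE('k::field) {1..n} \<Delta>)"
  shows "(generated_by_regular_seq (polynomial_ring TYPE('k) {1..n})
            (stanley_reisner_ideal TYPE('k) {1..n} \<Delta>) \<longleftrightarrow>
          (\<forall>F\<in>\<Delta>. complex_dim (link \<Delta> F) = 1 \<longrightarrow>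
             complete_intersection_complex TYPE('k) (link \<Delta> F))) \<and>
         (generated_by_regular_seq (polynomial_ring TYPE('k) {1..n})
            (stanley_reisner_ideal TYPE('k) {1..n} \<Delta>) \<longleftrightarrow>
          (\<exists>W\<subseteq>{1..n}. complex_dim (restriction \<Delta> ({1..n} - W)) \<le> complex_dim \<Delta> - 3 \<and>
             (\<forall>x\<in>W. complete_intersection_complex TYPE('k) (link \<Delta> {x}))))"
proof -
  have cpx: "finite_complex \<Delta>" and V: "{1..n} = \<Union>\<Delta>"
    using finite_complex_simplicial_complex[OF complex] by auto
  have conn: "connected_links \<Delta>"
    using connected_links_if_serre_S2[OF cpx] S2 unfolding V by blast
  have gen: "generated_by_regular_seq (polynomial_ring TYPE('k) {1..n})
      (stanley_reisner_ideal TYPE('k) {1..n} \<Delta>) \<longleftrightarrow> disjoint_nonfaces \<Delta>"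
    unfolding V by (rule generated_by_regular_seq_iff_disjoint_nonfaces[OF cpx])
  have ci: "complete_intersection_complex TYPE('k) (link \<Delta> F) \<longleftrightarrow> disjoint_nonfaces (link \<Delta> F)"
    if "F \<in> \<Delta>" for F
    unfolding complete_intersection_complex_def
    by (rule generated_by_regular_seq_iff_disjoint_nonfaces[OF finite_complex_link[OF cpx that]])
  have vertex: "{x} \<in> \<Delta>" if "x \<in> {1..n}" for x
    using that vertex_iff[OF cpx] V by blast
  have "1 \<le> complex_dim \<Delta>" using dim by simp
  note 21 = disjoint_nonfaces_if_one_dim_links[OF cpx conn this]
  have 13: "complex_dim (restriction \<Delta> ({1..n} - {1..n})) \<le> complex_dim \<Delta> - 3"
  proof -
    have "restriction \<Delta> ({1..n} - {1..n}) = {{}}"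
      using cpx unfolding restriction_def finite_complex_def by auto
    then show ?thesis using dim by (simp add: complex_dim_def face_dim_def)
  qed
  have 32: "disjoint_nonfaces (link \<Delta> F)"
    if W: "W \<subseteq> {1..n}" "complex_dim (restriction \<Delta> ({1..n} - W)) \<le> complex_dim \<Delta> - 3"
      "\<And>x. x \<in> W \<Longrightarrow> disjoint_nonfaces (link \<Delta> {x})"
      and F: "F \<in> \<Delta>" "complex_dim (link \<Delta> F) = 1" for W F
    using disjoint_nonfaces_one_dim_link[OF cpx conn W(2)[unfolded V] W(3) F] .
  have "disjoint_nonfaces \<Delta> \<longleftrightarrow>
      (\<forall>F\<in>\<Delta>. complex_dim (link \<Delta> F) = 1 \<longrightarrow> disjoint_nonfaces (link \<Delta> F))"
    using 21 disjoint_nonfaces_link[OF cpx] by blast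
  moreover have "disjoint_nonfaces \<Delta> \<longleftrightarrow>
      (\<exists>W\<subseteq>{1..n}. complex_dim (restriction \<Delta> ({1..n} - W)) \<le> complex_dim \<Delta> - 3 \<and>
        (\<forall>x\<in>W. disjoint_nonfaces (link \<Delta> {x})))"
  proof
    assume "disjoint_nonfaces \<Delta>"
    then show "\<exists>W\<subseteq>{1..n}. complex_dim (restriction \<Delta> ({1..n} - W)) \<le> complex_dim \<Delta> - 3 \<and>
        (\<forall>x\<in>W. disjoint_nonfaces (link \<Delta> {x}))"
      using 13 disjoint_nonfaces_link[OF cpx] vertex by (intro exI[of _ "{1..n}"]) blast
  next
    assume "\<exists>W\<subseteq>{1..n}. complex_dim (restriction \<Delta> ({1..n} - W)) \<le> complex_dim \<Delta> - 3 \<and>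
        (\<forall>x\<in>W. disjoint_nonfaces (link \<Delta> {x}))"
    then show "disjoint_nonfaces \<Delta>" using 32 21 by blast
  qed
  moreover have "(\<forall>x\<in>W. complete_intersection_complex TYPE('k) (link \<Delta> {x})) \<longleftrightarrow>
      (\<forall>x\<in>W. disjoint_nonfaces (link \<Delta> {x}))" if "W \<subseteq> {1..n}" for W
    using ci vertex that by blast
  ultimately show ?thesis
    unfolding gen using ci by (smt (verit))
qed

end
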